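(* Let $\lambda>0$ and let $\mathcal{F}$ be a collection of $\lambda$-Lipschitz maps between metric spaces. The following are equivalent: (i) $\mathcal{F}$ factors the Hamming cubes. (ii) $\mathcal{F}$ crudely factors the Hamming cubes. (iii) $\limsup_n a_n(\mathcal{F})>0$. (iv) For each $1<p<\infty$, $\limsup_n b_{p,n}(\mathcal{F})>0$. (v) For some $1<p<\infty$, $\limsup_n b_{p,n}(\mathcal{F})>0$.
   Context: Convention $\frac{0}{0}=0$. For a map $g:(U,d_U)\to(V,d_V)$, $\mathrm{Lip}(g)=\sup_{x,y\in U} d_V(g(x),g(y))/d_U(x,y)$. The Hamming cube $2^n=\{\pm1\}^n$ carries the normalized graph metric $\partial(\varepsilon,\delta)=\frac1n|\{i:\varepsilon(i)\neq\delta(i)\}|$ and the uniform probability measure $\mathbb{P}$ (expectation $\mathbb{E}$ over $\varepsilon\in 2^n$). $d_i$ flips the $i$-th coordinate. For $F:X\to Y$ and $f:2^n\to X$, set $\varrho^f_X(\varepsilon,\delta)=d_X(f(\varepsilon),f(\delta))$ and $\varrho^f_Y(\varepsilon,\delta)=d_Y(F\circ f(\varepsilon),F\circ f(\delta))$. $a_n(\mathcal{F})$ is the infimum of those $a>0$ such that for each $F:X\to Y$ in $\mathcal{F}$ and each $f:2^n\to X$, $\mathbb{E}\varrho^f_Y(\varepsilon,-\varepsilon)\le a\,\mathrm{Lip}(f)$. For $1<p<\infty$, $b_{p,n}(\mathcal{F})$ is the infimum of those $b>0$ such that for each $F:X\to Y$ in $\mathcal{F}$ and each $f:2^n\to X$,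 $\mathbb{E}\varrho^f_Y(\varepsilon,-\varepsilon)^p\le b^p n^{p-1}\sum_{i=1}^n \mathbb{E}\varrho^f_X(\varepsilon,d_i\varepsilon)^p$. $\mathcal{F}$ crudely factors the Hamming cubes if there exist $c,D>0$ such that for each $n$ there exist $F:X\to Y$ in $\mathcal{F}$, $f:2^n\to X$ and $a,b>0$ with $b\ge ac$ and, for all $\varepsilon,\delta\in 2^n$, $\frac aD\partial(\varepsilon,\delta)\le d_X(f(\varepsilon),f(\delta))\le aD\partial(\varepsilon,\delta)$ and $\frac bD\partial(\varepsilon,\delta)\le d_Y(F\circ f(\varepsilon),F\circ f(\delta))\le bD\partial(\varepsilon,\delta)$. $\mathcal{F}$ factors the Hamming cubes if there exists $c>0$ such that for each $D>1$ and each $n$ such $F,f,a,b$ exist. *)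

theory Defs
  imports "HOL-Analysis.Analysis"
begin

text \<open>Hamming cube 2^n, encoded as functions nat => bool that are False
  outside {0..<n}; True stands for +1, False for -1.\<close>
definition cube :: "nat \<Rightarrow> (nat \<Rightarrow> bool) set" where
  "cube n = {e. \<forall>i. n \<le> i \<longrightarrow> \<not> e i}"

definition cneg :: "nat \<Rightarrow> (nat \<Rightarrow> bool) \<Rightarrow> (nat \<Rightarrow> bool)" where
  "cneg n e = (\<lambda>i. if i < n then \<not> e i else e i)"

definition cflip :: "nat \<Rightarrow> (nat \<Rightarrow> bool) \<Rightarrow> (nat \<Rightarrow> bool)" where
  "cflip i e = e(i := \<not> e i)"

definition ham :: "nat \<Rightarrow> (nat \<Rightarrow> bool) \<Rightarrow> (nat \<Rightarrow> bool) \<Rightarrow> real" where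
  "ham n e d = real (card {i. i < n \<and> e i \<noteq> d i}) / real n"

definition cexp :: "nat \<Rightarrow> ((nat \<Rightarrow> bool) \<Rightarrow> real) \<Rightarrow> real" where
  "cexp n g = (\<Sum>e\<in>cube n. g e) / real (card (cube n))"

text \<open>Lip(f) for f : 2^n -> (X,dX), with the convention 0/0 = 0
  (which is also Isabelle's x/0 = 0)\<close>
definition cubeLip :: "nat \<Rightarrow> ('a \<Rightarrow> 'a \<Rightarrow> real) \<Rightarrow> ((nat \<Rightarrow> bool) \<Rightarrow> 'a) \<Rightarrow> real" where
  "cubeLip n dX f = Sup ((\<lambda>(e, d). dX (f e) (f d) / ham n e d) ` (cube n \<times> cube n))"

type_synonym ('a, 'b) metric_map =
  "'a set \<times> ('a \<Rightarrow> 'a \<Rightarrow> real) \<times> 'b set \<times> ('b \<Rightarrow> 'b \<Rightarrow> real) \<times> ('a \<Rightarrow> 'b)"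

definition lip_map :: "real \<Rightarrow> ('a, 'b) metric_map \<Rightarrow> bool" where
  "lip_map lam m = (case m of (X, dX, Y, dY, F) \<Rightarrow>
     Metric_space X dX \<and> Metric_space Y dY \<and> F \<in> X \<rightarrow> Y \<and>
     (\<forall>x\<in>X. \<forall>y\<in>X. dY (F x) (F y) \<le> lam * dX x y))"

definition a_const :: "('a, 'b) metric_map set \<Rightarrow> nat \<Rightarrow> real" where
  "a_const FF n = Inf {a. a > 0 \<and>
     (\<forall>(X, dX, Y, dY, F)\<in>FF. \<forall>f. f \<in> cube n \<rightarrow> X \<longrightarrow>
        cexp n (\<lambda>e. dY (F (f e)) (F (f (cneg n e)))) \<le> a * cubeLip n dX f)}"

definition b_const :: "('a, 'b) metric_map set \<Rightarrow> real \<Rightarrow> nat \<Rightarrow> real" where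
  "b_const FF p n = Inf {b. b > 0 \<and>
     (\<forall>(X, dX, Y, dY, F)\<in>FF. \<forall>f. f \<in> cube n \<rightarrow> X \<longrightarrow>
        cexp n (\<lambda>e. dY (F (f e)) (F (f (cneg n e))) powr p)
          \<le> b powr p * real n powr (p - 1) *
            (\<Sum>i<n. cexp n (\<lambda>e. dX (f e) (f (cflip i e)) powr p)))}"

definition factor_cond :: "('a, 'b) metric_map set \<Rightarrow> real \<Rightarrow> real \<Rightarrow> nat \<Rightarrow> bool" where
  "factor_cond FF c D n = (\<exists>(X, dX, Y, dY, F)\<in>FF. \<exists>f. f \<in> cube n \<rightarrow> X \<and>
     (\<exists>a>0. \<exists>b>0. b \<ge> a * c \<and>
       (\<forall>e\<in>cube n. \<forall>d\<in>cube n.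
          a / D * ham n e d \<le> dX (f e) (f d) \<and> dX (f e) (f d) \<le> a * D * ham n e d \<and>
          b / D * ham n e d \<le> dY (F (f e)) (F (f d)) \<and>
          dY (F (f e)) (F (f d)) \<le> b * D * ham n e d)))"

definition factors_cubes :: "('a, 'b) metric_map set \<Rightarrow> bool" where
  "factors_cubes FF = (\<exists>c>0. \<forall>D>1. \<forall>n. factor_cond FF c D n)"

definition crudely_factors_cubes :: "('a, 'b) metric_map set \<Rightarrow> bool" where
  "crudely_factors_cubes FF = (\<exists>c>0. \<exists>D>0. \<forall>n. factor_cond FF c D n)"

end

theory Submission
  imports Defs "HOL-Combinatorics.Permutations"
begin

text \<open>The hard implication is that large constants \<open>b\<^bsub>p,n\<^esub>\<close> (or \<open>a\<^sub>n\<close>) yield nearly isometric cubes.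
  For a pseudometric \<open>\<rho>\<close> on the \<open>n\<close>-cube let \<open>H(k)\<close> be the average of \<open>(\<rho> / k)\<^sup>p\<close> over pairs of vertices
  differing in exactly \<open>k\<close> coordinates. By convexity \<open>k H(k)\<close> is subadditive, so \<open>H(m k) \<le> H(k)\<close>.
  A violation of the \<open>b\<^bsub>p,n\<^esub>\<close> inequality keeps \<open>H\<^sub>X\<close> and \<open>H\<^sub>Y\<close> between two comparable bounds at all scales,
  so among many scales \<open>q m\<^sup>j\<close> there is one where both hardly drop from \<open>k\<close> to \<open>m k\<close>.
  On a suitable grid of \<open>m\<close> disjoint random blocks of size \<open>k\<close> the power mean inequality is then almost an
  equality along every geodesic between antipodes, simultaneously in \<open>X\<close> and \<open>Y\<close>; strict convexity of
  \<open>t\<^sup>p\<close> makes all edges of the grid nearly equal and all geodesics nearly tight.\<close>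

section \<open>Strict convexity of powers\<close>

text \<open>The gap between t^p and its tangent at 1 has derivative p (z^(p-1) - 1), negative below
  1 and positive above. The strictness later turns near-equality in power means into
  rigidity.\<close>

lemma powr_tangent_gap_mono:
  fixes p :: real
  assumes "1 < p"
  shows "\<lbrakk>0 \<le> x; x < y; y \<le> 1\<rbrakk> \<Longrightarrow> y powr p - 1 - p * (y - 1) < x powr p - 1 - p * (x - 1)"
    and "\<lbrakk>1 \<le> x; x < y\<rbrakk> \<Longrightarrow> x powr p - 1 - p * (x - 1) < y powr p - 1 - p * (y - 1)"
proof -
  let ?g = "\<lambda>x::real. x powr p - 1 - p * (x - 1)"
  have cont: "continuous_on {0..} ?g"
    using assms by (intro continuous_intros continuous_on_powr') auto
  have der: "(?g has_real_derivative p * (z powr (p - 1) - 1)) (at z)" if "z > 0" for z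
    using that by (auto intro!: derivative_eq_intros simp: algebra_simps)
  show "?g y < ?g x" if "0 \<le> x" "x < y" "y \<le> 1"
  proof (rule DERIV_neg_imp_decreasing_open[OF \<open>x < y\<close>])
    fix z assume z: "x < z" "z < y"
    have "z powr (p - 1) < 1"
      using z that assms powr_less_mono2[of "p - 1" z 1] by auto
    with z that assms show "\<exists>d. DERIV ?g z :> d \<and> d < 0"
      by (intro exI[of _ "p * (z powr (p - 1) - 1)"] conjI der) (auto simp: mult_less_0_iff)
  qed (rule continuous_on_subset[OF cont], use that in auto)
  show "?g x < ?g y" if "1 \<le> x" "x < y"
  proof (rule DERIV_pos_imp_increasing_open[OF \<open>x < y\<close>])
    fix z assume z: "x < z" "z < y"
    have "1 < z powr (p - 1)"
      using z that assms powr_less_mono2[of "p - 1" 1 z] by auto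
    with z that assms show "\<exists>d. DERIV ?g z :> d \<and> d > 0"
      by (intro exI[of _ "p * (z powr (p - 1) - 1)"] conjI der) auto
  qed (rule continuous_on_subset[OF cont], use that in auto)
qed

lemma powr_tangent_gap_nonneg:
  fixes p :: real
  assumes "1 < p" "0 \<le> x"
  shows "0 \<le> x powr p - 1 - p * (x - 1)"
  using powr_tangent_gap_mono(1)[OF assms(1), of x 1] powr_tangent_gap_mono(2)[OF assms(1), of 1 x] assms
  by (cases "x < 1"; cases "x = 1") auto

text \<open>The tangent inequality at u_i = W x_i / (t w_i), with W the total weight, is summed with
  weights w_i; the linear part is nonnegative because t is at most the sum of the x_i. That
  one-sided hypothesis is the triangle inequality: t will be a distance, the x_i the steps of a
  path.\<close>

lemma weighted_power_mean:
  fixes p :: real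
  assumes "1 < p" "finite I" "\<And>i. i \<in> I \<Longrightarrow> 0 < w i" "\<And>i. i \<in> I \<Longrightarrow> 0 \<le> x i"
    and "0 \<le> t" "t \<le> (\<Sum>i\<in>I. x i)"
  shows "t powr p \<le> (\<Sum>i\<in>I. w i) powr (p - 1) * (\<Sum>i\<in>I. w i powr (1 - p) * x i powr p)"
proof (cases "t = 0 \<or> I = {}")
  case True
  then show ?thesis using assms by (auto intro!: mult_nonneg_nonneg sum_nonneg)
next
  case False
  define W where "W = (\<Sum>i\<in>I. w i)"
  have t: "t > 0" and W: "W > 0" using False assms by (auto simp: W_def intro!: sum_pos)
  define u where "u i = W * x i / (t * w i)" for i
  have u: "0 \<le> u i" if "i \<in> I" for i
    using assms(3,4)[OF that] t W by (auto simp: u_def)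
  have "0 \<le> (\<Sum>i\<in>I. w i * (u i powr p - 1 - p * (u i - 1)))"
    using assms(1,3) u
    by (intro sum_nonneg mult_nonneg_nonneg powr_tangent_gap_nonneg) (auto intro: less_imp_le)
  also have "\<dots> = (\<Sum>i\<in>I. w i * u i powr p) - W - p * ((\<Sum>i\<in>I. w i * u i) - W)"
    by (simp add: W_def algebra_simps sum.distrib sum_subtractf sum_distrib_left)
  finally have 1: "p * ((\<Sum>i\<in>I. w i * u i) - W) \<le> (\<Sum>i\<in>I. w i * u i powr p) - W" by simp
  have "(\<Sum>i\<in>I. w i * u i) = (\<Sum>i\<in>I. W / t * x i)"
    using assms(3) t by (intro sum.cong refl) (force simp: u_def field_simps)
  also have "\<dots> = W / t * (\<Sum>i\<in>I. x i)" by (simp add: sum_distrib_left)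
  also have "\<dots> \<ge> W / t * t" using assms(6) t W by (intro mult_left_mono) auto
  finally have "0 \<le> (\<Sum>i\<in>I. w i * u i) - W" using t by simp
  then have "0 \<le> p * ((\<Sum>i\<in>I. w i * u i) - W)" using assms(1) by (intro mult_nonneg_nonneg) auto
  with 1 have 2: "W \<le> (\<Sum>i\<in>I. w i * u i powr p)" by simp
  have "w i * u i powr p = W powr p / t powr p * (w i powr (1 - p) * x i powr p)" if "i \<in> I" for i
    using assms(3,4)[OF that] t W
    by (simp add: u_def powr_mult powr_divide powr_diff field_simps)
  then have "(\<Sum>i\<in>I. w i * u i powr p) = W powr p / t powr p * (\<Sum>i\<in>I. w i powr (1 - p) * x i powr p)"
    by (simp add: sum_distrib_left)
  with 2 have "W \<le> W powr p / t powr p * (\<Sum>i\<in>I. w i powr (1 - p) * x i powr p)" by simp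
  then have "t powr p \<le> W powr p / W * (\<Sum>i\<in>I. w i powr (1 - p) * x i powr p)"
    using t W by (simp add: field_simps)
  then show ?thesis using W by (simp add: W_def powr_diff)
qed

lemma power_mean:
  fixes p :: real
  assumes "1 < p" "\<And>j. j < m \<Longrightarrow> 0 \<le> x j" "0 \<le> t" "t \<le> (\<Sum>j<m. x j)"
  shows "t powr p \<le> real m powr (p - 1) * (\<Sum>j<m. x j powr p)"
  using weighted_power_mean[of p "{..<m}" "\<lambda>_. 1" x t] assms by simp

text \<open>After rescaling to y_i = m x_i / t, all tangent gaps are nonnegative and their sum is at
  most m \<xi>. So each gap stays below its values at 1 - \<kappa> and 1 + \<kappa>, and
  monotonicity on either side of 1 confines every y_j.\<close>

lemma power_mean_stability:
  fixes p \<kappa> :: real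
  assumes p: "1 < p" and m: "0 < m" and \<kappa>: "0 < \<kappa>" "\<kappa> < 1"
  obtains \<xi> where "0 < \<xi>" and
    "\<And>x t j. \<lbrakk>\<And>j. j < m \<Longrightarrow> 0 \<le> x j; 0 < t; t \<le> (\<Sum>j<m. x j);
       real m powr (p - 1) * (\<Sum>j<m. x j powr p) - t powr p \<le> \<xi> * t powr p; j < m\<rbrakk>
     \<Longrightarrow> \<bar>real m * x j - t\<bar> \<le> \<kappa> * t"
proof -
  define g where "g x = x powr p - 1 - p * (x - 1)" for x :: real
  define \<mu> where "\<mu> = min (g (1 - \<kappa>)) (g (1 + \<kappa>))"
  \<comment> \<open>The factor 2 makes the total gap at most \<mu> / 2, hence strictly below
    \<mu>.\<close>
  define \<xi> where "\<xi> = \<mu> / (2 * real m)"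
  have g1: "g 1 = 0" by (simp add: g_def)
  have \<mu>: "\<mu> > 0"
    using powr_tangent_gap_mono(1)[OF p, of "1 - \<kappa>" 1] powr_tangent_gap_mono(2)[OF p, of 1 "1 + \<kappa>"] \<kappa> g1
    by (auto simp: \<mu>_def g_def)
  show ?thesis
  proof (rule that[of \<xi>])
    show "0 < \<xi>" using \<mu> m by (simp add: \<xi>_def)
    fix x :: "nat \<Rightarrow> real" and t j
    assume x: "\<And>j. j < m \<Longrightarrow> 0 \<le> x j" and t: "0 < t" "t \<le> (\<Sum>j<m. x j)"
      and def: "real m powr (p - 1) * (\<Sum>j<m. x j powr p) - t powr p \<le> \<xi> * t powr p" and j: "j < m"
    define y where "y i = real m * x i / t" for i
    have y: "0 \<le> y i" if "i < m" for i using x[OF that] t by (simp add: y_def)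
    have "g (y j) \<le> (\<Sum>i<m. g (y i))"
      using y j powr_tangent_gap_nonneg[OF p] by (intro member_le_sum) (auto simp: g_def)
    also have "\<dots> = (\<Sum>i<m. y i powr p) - m - p * ((\<Sum>i<m. y i) - m)"
      by (simp add: g_def algebra_simps sum.distrib sum_subtractf sum_distrib_left)
    also have "\<dots> \<le> (\<Sum>i<m. y i powr p) - m"
    proof -
      have "(\<Sum>i<m. y i) = m / t * (\<Sum>j<m. x j)" by (simp add: y_def sum_distrib_left)
      also have "\<dots> \<ge> m / t * t" using t by (intro mult_left_mono) auto
      finally have "0 \<le> (\<Sum>i<m. y i) - m" using t by simp
      then have "0 \<le> p * ((\<Sum>i<m. y i) - m)" using p by (intro mult_nonneg_nonneg) auto
      then show ?thesis by simp
    qed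
    also have "(\<Sum>i<m. y i powr p) = real m powr p / t powr p * (\<Sum>i<m. x i powr p)"
      using x t by (simp add: y_def powr_mult powr_divide sum_distrib_left)
    also have "\<dots> = m * (real m powr (p - 1) * (\<Sum>i<m. x i powr p)) / t powr p"
      using m by (simp add: powr_diff)
    also have "\<dots> \<le> m * ((1 + \<xi>) * t powr p) / t powr p"
      using def t by (intro divide_right_mono mult_left_mono) (auto simp: algebra_simps)
    also have "\<dots> = m + m * \<xi>" using t by (simp add: field_simps)
    finally have "g (y j) < \<mu>" using m \<mu> by (simp add: \<xi>_def)
    then have "\<bar>y j - 1\<bar> \<le> \<kappa>"
      using powr_tangent_gap_mono(1)[OF p, of "y j" "1 - \<kappa>"] powr_tangent_gap_mono(2)[OF p, of "1 + \<kappa>" "y j"]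
        y[OF j] \<kappa>
      by (force simp: \<mu>_def g_def abs_le_iff)
    then have "\<bar>y j - 1\<bar> * t \<le> \<kappa> * t" using t by (intro mult_right_mono) auto
    moreover have "\<bar>y j - 1\<bar> * t = \<bar>real m * x j - t\<bar>"
      using t by (simp add: y_def abs_mult_pos' field_simps flip: abs_mult_pos)
    ultimately show "\<bar>real m * x j - t\<bar> \<le> \<kappa> * t" by simp
  qed
qed

section \<open>Hamming cubes\<close>

definition flip_on :: "nat set \<Rightarrow> (nat \<Rightarrow> bool) \<Rightarrow> nat \<Rightarrow> bool" where
  "flip_on S e = (\<lambda>i. if i \<in> S then \<not> e i else e i)"

lemma in_cube_imp_less: "\<lbrakk>e \<in> cube n; e i\<rbrakk> \<Longrightarrow> i < n"
  unfolding cube_def using not_le by blast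

lemma flip_on_empty [simp]: "flip_on {} e = e"
  by (simp add: flip_on_def)

lemma flip_on_twice: "flip_on S (flip_on T e) = flip_on (sym_diff S T) e"
  by (auto simp: flip_on_def)

lemma flip_on_in_cube: "\<lbrakk>S \<subseteq> {..<n}; e \<in> cube n\<rbrakk> \<Longrightarrow> flip_on S e \<in> cube n"
  by (force simp: flip_on_def cube_def)

lemma flip_on_insert: "i \<notin> S \<Longrightarrow> flip_on (insert i S) e = cflip i (flip_on S e)"
  by (auto simp: flip_on_def cflip_def fun_eq_iff)

lemma flip_on_differ: "flip_on {i. e i \<noteq> d i} e = d"
  by (auto simp: flip_on_def)

lemma cneg_eq_flip_on: "cneg n e = flip_on {..<n} e"
  by (auto simp: cneg_def flip_on_def)

lemma cflip_eq_flip_on: "cflip i e = flip_on {i} e"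
  by (auto simp: cflip_def flip_on_def)

lemma cflip_in_cube: "\<lbrakk>i < n; e \<in> cube n\<rbrakk> \<Longrightarrow> cflip i e \<in> cube n"
  by (auto simp: cflip_eq_flip_on intro: flip_on_in_cube)

lemma cneg_in_cube: "e \<in> cube n \<Longrightarrow> cneg n e \<in> cube n"
  by (auto simp: cneg_eq_flip_on intro: flip_on_in_cube)

lemma differ_subset: "\<lbrakk>e \<in> cube n; d \<in> cube n\<rbrakk> \<Longrightarrow> {i. e i \<noteq> d i} \<subseteq> {..<n}"
  using in_cube_imp_less by blast

lemma finite_cube: "finite (cube n)"
proof -
  have "cube n \<subseteq> (\<lambda>S i. i \<in> S) ` Pow {..<n}"
  proof
    fix e assume "e \<in> cube n"
    then show "e \<in> (\<lambda>S i. i \<in> S) ` Pow {..<n}"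
      by (intro image_eqI[of _ _ "{i. e i}"]) (auto intro: in_cube_imp_less)
  qed
  then show ?thesis by (rule finite_subset) simp
qed

lemma zero_in_cube: "(\<lambda>_. False) \<in> cube n"
  by (simp add: cube_def)

lemma card_cube_pos: "0 < card (cube n)"
  using finite_cube zero_in_cube by (auto simp: card_gt_0_iff)

lemma bij_betw_flip_on: "S \<subseteq> {..<n} \<Longrightarrow> bij_betw (flip_on S) (cube n) (cube n)"
  by (rule bij_betw_byWitness[where f' = "flip_on S"])
    (auto simp: flip_on_twice intro: flip_on_in_cube)

lemma ham_eq: "\<lbrakk>e \<in> cube n; d \<in> cube n\<rbrakk> \<Longrightarrow> ham n e d = real (card {i. e i \<noteq> d i}) / real n"
  using differ_subset[of e n d] by (auto simp: ham_def intro!: arg_cong[where f = card])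

text \<open>Bijections of A, of B minus A and of U minus B onto their counterparts are glued. The
  chain of two sets lets a walk be steered through a prescribed edge; with B and B' both equal to U,
  only the sizes of A and A' matter.\<close>

lemma ex_permutes_chain:
  assumes "finite U" "A \<subseteq> B" "B \<subseteq> U" "A' \<subseteq> B'" "B' \<subseteq> U" "card A = card A'" "card B = card B'"
  obtains \<sigma> where "\<sigma> permutes U" "\<sigma> ` A = A'" "\<sigma> ` B = B'"
proof -
  have fin: "finite A" "finite A'" "finite B" "finite B'"
    using assms by (meson finite_subset)+
  have "card (B - A) = card (B' - A')" "card (U - B) = card (U - B')"
    using assms fin by (simp_all add: card_Diff_subset)
  then obtain f g h where f: "bij_betw f A A'" and g: "bij_betw g (B - A) (B' - A')"
    and h: "bij_betw h (U - B) (U - B')"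
    using assms fin by (metis finite_same_card_bij finite_Diff)
  define s where "s x = (if x \<in> A then f x else if x \<in> B then g x else if x \<in> U then h x else x)" for x
  have sA: "bij_betw s A A'" by (rule bij_betw_cong[THEN iffD2, OF _ f]) (auto simp: s_def)
  have sB: "bij_betw s (B - A) (B' - A')"
    by (rule bij_betw_cong[THEN iffD2, OF _ g]) (auto simp: s_def)
  have sU: "bij_betw s (U - B) (U - B')"
    using assms(2) by (intro bij_betw_cong[THEN iffD2, OF _ h]) (auto simp: s_def)
  have "bij_betw s (A \<union> (B - A)) (A' \<union> (B' - A'))"
    using sA sB by (rule bij_betw_combine) auto
  then have sAB: "bij_betw s B B'" using assms by (simp add: Un_absorb1)
  have "bij_betw s (B \<union> (U - B)) (B' \<union> (U - B'))"
    using sAB sU by (rule bij_betw_combine) auto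
  then have "bij_betw s U U" using assms by (simp add: Un_absorb1)
  then have "s permutes U" using assms by (intro bij_imp_permutes) (auto simp: s_def)
  with sA sAB show ?thesis using that by (auto simp: bij_betw_def)
qed

section \<open>Rigidity of pseudometrics with small defects\<close>

text \<open>For a permutation \<open>\<sigma>\<close> of the coordinates this is a geodesic of the
  Hamming cube from \<open>e\<close> to its antipode.\<close>

definition walk :: "(nat \<Rightarrow> nat) \<Rightarrow> (nat \<Rightarrow> bool) \<Rightarrow> nat \<Rightarrow> nat \<Rightarrow> bool" where
  "walk \<sigma> e j = flip_on (\<sigma> ` {..<j}) e"

text \<open>The slack in the power mean inequality along the geodesic given by
  \<open>\<sigma>\<close>. For a pseudometric, p > 1 and n > 0, it vanishes only if all steps are
  equal and add up to the antipodal distance.\<close>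

definition defect :: "real \<Rightarrow> nat \<Rightarrow> ((nat \<Rightarrow> bool) \<Rightarrow> (nat \<Rightarrow> bool) \<Rightarrow> real) \<Rightarrow>
    (nat \<Rightarrow> bool) \<Rightarrow> (nat \<Rightarrow> nat) \<Rightarrow> real" where
  "defect p n \<rho> e \<sigma> = real n powr (p - 1) * (\<Sum>j<n. \<rho> (walk \<sigma> e j) (walk \<sigma> e (Suc j)) powr p)
     - \<rho> e (cneg n e) powr p"

lemma walk_Suc: "\<sigma> permutes S \<Longrightarrow> walk \<sigma> e (Suc j) = cflip (\<sigma> j) (walk \<sigma> e j)"
  using permutes_inj[of \<sigma> S]
  by (auto simp: walk_def lessThan_Suc dest: injD intro!: flip_on_insert)

lemma walk_in_cube: "\<lbrakk>\<sigma> permutes {..<n}; e \<in> cube n; j \<le> n\<rbrakk> \<Longrightarrow> walk \<sigma> e j \<in> cube n"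
  by (auto simp: walk_def permutes_in_image intro!: flip_on_in_cube)
    (metis lessThan_iff order_less_le_trans permutes_in_image)

lemma walk_full: "\<sigma> permutes {..<n} \<Longrightarrow> walk \<sigma> e n = cneg n e"
  by (simp add: walk_def cneg_eq_flip_on permutes_image)

text \<open>Distances are pulled back through maps that need not be injective, so distinct vertices
  may be at distance 0.\<close>

locale cube_pmetric =
  fixes n :: nat and \<rho> :: "(nat \<Rightarrow> bool) \<Rightarrow> (nat \<Rightarrow> bool) \<Rightarrow> real"
  assumes nonneg: "\<lbrakk>e \<in> cube n; d \<in> cube n\<rbrakk> \<Longrightarrow> 0 \<le> \<rho> e d"
    and refl: "e \<in> cube n \<Longrightarrow> \<rho> e e = 0"
    and commute: "\<lbrakk>e \<in> cube n; d \<in> cube n\<rbrakk> \<Longrightarrow> \<rho> e d = \<rho> d e"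
    and triangle: "\<lbrakk>x \<in> cube n; y \<in> cube n; z \<in> cube n\<rbrakk> \<Longrightarrow> \<rho> x z \<le> \<rho> x y + \<rho> y z"
begin

lemma path_le:
  "(\<And>j. j \<le> l \<Longrightarrow> v j \<in> cube n) \<Longrightarrow> \<rho> (v 0) (v l) \<le> (\<Sum>j<l. \<rho> (v j) (v (Suc j)))"
proof (induction l)
  case 0
  then show ?case by (simp add: refl)
next
  case (Suc l)
  have "\<rho> (v 0) (v (Suc l)) \<le> \<rho> (v 0) (v l) + \<rho> (v l) (v (Suc l))"
    using Suc.prems by (intro triangle) auto
  with Suc show ?case by force
qed

lemma walk_le:
  assumes "\<sigma> permutes {..<n}" "e \<in> cube n"
  shows "\<rho> e (cneg n e) \<le> (\<Sum>j<n. \<rho> (walk \<sigma> e j) (walk \<sigma> e (Suc j)))"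
  using path_le[of n "walk \<sigma> e"] walk_in_cube[OF assms] walk_full[OF assms(1)]
  by (simp add: walk_def)

lemma defect_nonneg:
  assumes "1 < p" "\<sigma> permutes {..<n}" "e \<in> cube n"
  shows "0 \<le> defect p n \<rho> e \<sigma>"
proof -
  have "\<rho> e (cneg n e) powr p
      \<le> real n powr (p - 1) * (\<Sum>j<n. \<rho> (walk \<sigma> e j) (walk \<sigma> e (Suc j)) powr p)"
    using assms by (intro power_mean walk_le nonneg walk_in_cube cneg_in_cube) auto
  then show ?thesis by (simp add: defect_def)
qed

lemma le_of_edge_le:
  assumes "\<And>x i. \<lbrakk>x \<in> cube n; i < n\<rbrakk> \<Longrightarrow> \<rho> x (cflip i x) \<le> E" "e \<in> cube n" "d \<in> cube n"
  shows "\<rho> e d \<le> real (card {i. e i \<noteq> d i}) * E"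
proof -
  have "S \<subseteq> {..<n} \<Longrightarrow> \<rho> e (flip_on S e) \<le> real (card S) * E" if "finite S" for S
    using that
  proof (induction S rule: finite_induct)
    case empty
    then show ?case using assms by (simp add: refl)
  next
    case (insert i S)
    have "\<rho> e (flip_on (insert i S) e) \<le> \<rho> e (flip_on S e) + \<rho> (flip_on S e) (flip_on (insert i S) e)"
      using insert assms by (intro triangle flip_on_in_cube) auto
    also have "\<rho> (flip_on S e) (flip_on (insert i S) e) \<le> E"
      unfolding flip_on_insert[OF insert.hyps(2)]
      using insert assms(2) by (intro assms(1) flip_on_in_cube) auto
    also have "\<rho> e (flip_on S e) \<le> card S * E" using insert by auto
    finally show ?case using insert by (simp add: algebra_simps)
  qed
  then show ?thesis
    using differ_subset[OF assms(2,3)] flip_on_differ[of e d] by (metis finite_lessThan finite_subset)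
qed

end

text \<open>Stability of power means along geodesics from the all-False vertex fixes every edge
  length near a / m, which bounds distances from above. The defects at the other vertices keep all
  antipodal distances from falling much below \<open>a\<close>; lower bounds follow by subtracting
  the rest of a geodesic through \<open>d\<close> to the antipode of \<open>e\<close>.\<close>

lemma small_defect_rigidity:
  fixes p D :: real
  assumes p: "1 < p" and m: "0 < m" and D: "1 < D"
  obtains \<xi> where "0 < \<xi>" and
    "\<And>\<rho> a e d. \<lbrakk>cube_pmetric m \<rho>; a = \<rho> (\<lambda>_. False) (cneg m (\<lambda>_. False)); 0 < a;
       \<And>e \<sigma>. \<lbrakk>e \<in> cube m; \<sigma> permutes {..<m}\<rbrakk> \<Longrightarrow> defect p m \<rho> e \<sigma> \<le> \<xi> * a powr p;
       e \<in> cube m; d \<in> cube m\<rbrakk>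
     \<Longrightarrow> a / D * ham m e d \<le> \<rho> e d \<and> \<rho> e d \<le> a * D * ham m e d"
proof -
  \<comment> \<open>The three bounds serve the upper estimate, the positivity of 1 - 2 \<kappa>, and
    the lower estimate, where a loss of 3 m \<kappa> must be absorbed in passing from 1 to 1 /
    D.\<close>
  define \<kappa> where "\<kappa> = min (D - 1) (min (1 / 4) ((1 - 1 / D) / (3 * real m)))"
  have "\<kappa> \<le> 1 / 4"
    unfolding \<kappa>_def by (rule min.coboundedI2, rule min.cobounded1)
  then have \<kappa>: "0 < \<kappa>" "\<kappa> < 1 / 2" "1 + \<kappa> \<le> D" using D m by (auto simp: \<kappa>_def)
  have "\<kappa> \<le> (1 - 1 / D) / (3 * real m)" by (simp add: \<kappa>_def)
  then have \<kappa>m: "1 / D \<le> 1 - 3 * real m * \<kappa>" using m by (simp add: field_simps)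
  obtain \<xi>1 where \<xi>1: "0 < \<xi>1" and stab:
    "\<And>x t j. \<lbrakk>\<And>j. j < m \<Longrightarrow> 0 \<le> x j; 0 < t; t \<le> (\<Sum>j<m. x j);
       real m powr (p - 1) * (\<Sum>j<m. x j powr p) - t powr p \<le> \<xi>1 * t powr p; j < m\<rbrakk>
     \<Longrightarrow> \<bar>real m * x j - t\<bar> \<le> \<kappa> * t"
    by (rule power_mean_stability[OF p m \<kappa>(1)]) (use \<kappa> in auto)
  \<comment> \<open>The second bound is the error allowed in passing from edges of length at least
    (1 - \<kappa>) a / m to antipodal distances of at least (1 - 2 \<kappa>) a.\<close>
  define \<xi> where "\<xi> = min \<xi>1 ((1 - \<kappa>) powr p - (1 - 2 * \<kappa>) powr p)"
  have \<xi>: "0 < \<xi>" "\<xi> \<le> \<xi>1" "\<xi> \<le> (1 - \<kappa>) powr p - (1 - 2 * \<kappa>) powr p"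
    using \<xi>1 \<kappa> p by (auto simp: \<xi>_def intro!: powr_less_mono2)
  show ?thesis
  proof (rule that[OF \<xi>(1)])
    fix \<rho> a e d
    assume "cube_pmetric m \<rho>" and a: "a = \<rho> (\<lambda>_. False) (cneg m (\<lambda>_. False))" "0 < a"
      and def: "\<And>e \<sigma>. \<lbrakk>e \<in> cube m; \<sigma> permutes {..<m}\<rbrakk> \<Longrightarrow> defect p m \<rho> e \<sigma> \<le> \<xi> * a powr p"
      and ed: "e \<in> cube m" "d \<in> cube m"
    interpret cube_pmetric m \<rho> by fact
    let ?z = "\<lambda>_::nat. False"
    \<comment> \<open>Every edge lies on a shortest path from the all-False vertex to its antipode.\<close>
    have edge0: "\<bar>real m * \<rho> x (cflip i x) - a\<bar> \<le> \<kappa> * a" if x: "x \<in> cube m" "i < m" "\<not> x i" for x i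
    proof -
      let ?T = "{j. x j}"
      have T: "?T \<subseteq> {..<m}" using x by (auto intro: in_cube_imp_less)
      then have finT: "finite ?T" by (rule finite_subset) simp
      have cT: "card (insert i ?T) = Suc (card ?T)" using finT x by simp
      moreover have "card (insert i ?T) \<le> card {..<m}" using T x by (intro card_mono) auto
      ultimately have hm: "card ?T < m" by simp
      obtain \<sigma> where \<sigma>: "\<sigma> permutes {..<m}" "\<sigma> ` {..<card ?T} = ?T"
          "\<sigma> ` {..<Suc (card ?T)} = insert i ?T"
        by (rule ex_permutes_chain[of "{..<m}" "{..<card ?T}" "{..<Suc (card ?T)}" ?T "insert i ?T"])
          (use T x hm cT in auto)
      have w: "walk \<sigma> ?z (card ?T) = x" "walk \<sigma> ?z (Suc (card ?T)) = cflip i x"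
        unfolding walk_def \<sigma> using x by (auto simp: flip_on_def cflip_def fun_eq_iff)
      have "\<bar>real m * \<rho> (walk \<sigma> ?z (card ?T)) (walk \<sigma> ?z (Suc (card ?T))) - a\<bar> \<le> \<kappa> * a"
      proof (rule stab[where x = "\<lambda>j. \<rho> (walk \<sigma> ?z j) (walk \<sigma> ?z (Suc j))"])
        have "\<xi> * a powr p \<le> \<xi>1 * a powr p" using \<xi> by (intro mult_right_mono) auto
        with def[OF zero_in_cube \<sigma>(1)]
        show "real m powr (p - 1) * (\<Sum>j<m. \<rho> (walk \<sigma> ?z j) (walk \<sigma> ?z (Suc j)) powr p) - a powr p
          \<le> \<xi>1 * a powr p"
          by (simp add: defect_def a(1))
      qed (use a hm walk_le[OF \<sigma>(1) zero_in_cube] in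
            \<open>auto intro!: nonneg walk_in_cube[OF \<sigma>(1)] zero_in_cube\<close>)
      then show ?thesis by (simp add: w)
    qed
    have edge: "\<bar>real m * \<rho> x (cflip i x) - a\<bar> \<le> \<kappa> * a" if x: "x \<in> cube m" "i < m" for x i
    proof (cases "x i")
      case True
      have "cflip i (cflip i x) = x" by (auto simp: cflip_def)
      with edge0[of "cflip i x" i] x True commute[of x "cflip i x"] cflip_in_cube[of i m x]
      show ?thesis by (simp add: cflip_def)
    qed (use edge0 x in auto)
    have up: "\<rho> x y \<le> real (card {i. x i \<noteq> y i}) * ((1 + \<kappa>) * a / m)"
      if "x \<in> cube m" "y \<in> cube m" for x y
    proof (rule le_of_edge_le[OF _ that])
      fix x i assume "x \<in> cube m" "i < m"
      from edge[OF this] show "\<rho> x (cflip i x) \<le> (1 + \<kappa>) * a / m"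
        using m by (simp add: field_simps abs_le_iff)
    qed
    have anti: "(1 - 2 * \<kappa>) * a \<le> \<rho> e (cneg m e)"
    proof -
      have low: "(1 - \<kappa>) * a / m \<le> \<rho> (walk id e j) (walk id e (Suc j))" if "j < m" for j
        using edge[of "walk id e j" j] walk_in_cube[of id m e j] walk_Suc[of id "{..<m}"] that ed m
        by (simp add: permutes_id field_simps abs_le_iff)
      have "(1 - \<kappa>) powr p * a powr p = real m powr (p - 1) * (\<Sum>j<m. ((1 - \<kappa>) * a / m) powr p)"
        using m \<kappa> a by (simp add: powr_mult powr_divide powr_diff)
      also have "\<dots> \<le> real m powr (p - 1) *
          (\<Sum>j<m. \<rho> (walk id e j) (walk id e (Suc j)) powr p)"
        using low \<kappa> a p by (intro mult_left_mono sum_mono powr_mono2) auto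
      also have "\<dots> \<le> \<rho> e (cneg m e) powr p + \<xi> * a powr p"
        using def[OF ed(1) permutes_id] by (simp add: defect_def)
      also have "\<dots> \<le> \<rho> e (cneg m e) powr p + ((1 - \<kappa>) powr p - (1 - 2 * \<kappa>) powr p) * a powr p"
        using \<xi>(3) by (intro add_left_mono mult_right_mono) auto
      finally have "((1 - 2 * \<kappa>) * a) powr p \<le> \<rho> e (cneg m e) powr p"
        using \<kappa> a(2) powr_mult[of "1 - 2 * \<kappa>" a p] by (simp add: left_diff_distrib)
      moreover have "0 \<le> \<rho> e (cneg m e)" using ed by (intro nonneg cneg_in_cube)
      ultimately show ?thesis using p powr_less_mono2[of p "\<rho> e (cneg m e)" "(1 - 2 * \<kappa>) * a"]
        by linarith
    qed
    let ?h = "card {i. e i \<noteq> d i}"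
    have sub: "{i. e i \<noteq> d i} \<subseteq> {..<m}" using ed by (rule differ_subset)
    have upper: "\<rho> e d \<le> a * D * ham m e d"
    proof -
      have "real ?h * ((1 + \<kappa>) * a / m) \<le> real ?h * (D * a / m)"
        using \<kappa> a m by (intro mult_left_mono divide_right_mono mult_right_mono) auto
      with up[OF ed] show ?thesis using ham_eq[OF ed] by (simp add: mult.commute)
    qed
    have lower: "a / D * ham m e d \<le> \<rho> e d"
    proof (cases "?h = 0")
      case True
      then show ?thesis using ham_eq[OF ed] nonneg[OF ed] by simp
    next
      case False
      have hm: "?h \<le> m" using card_mono[OF _ sub] by simp
      \<comment> \<open>\<open>d\<close> lies on a geodesic from \<open>e\<close> to its antipode,
        so \<open>\<rho> e d\<close> is at least the antipodal distance minus an upper bound for the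
        remaining \<open>m - ?h\<close> edges.\<close>
      have "{i. d i \<noteq> cneg m e i} = {..<m} - {i. e i \<noteq> d i}"
        using sub ed by (auto simp: cneg_def cube_def)
      then have "card {i. d i \<noteq> cneg m e i} = m - ?h"
        using sub by (simp add: card_Diff_subset finite_subset)
      with up[of d "cneg m e"] ed have "\<rho> d (cneg m e) \<le> (real m - ?h) * ((1 + \<kappa>) * a / m)"
        using hm by (simp add: cneg_in_cube of_nat_diff)
      with anti triangle[of e d "cneg m e"] ed
      have "(1 - 2 * \<kappa>) * a - (real m - ?h) * ((1 + \<kappa>) * a / m) \<le> \<rho> e d"
        by (auto simp: cneg_in_cube)
      moreover have "(1 - 2 * \<kappa>) * a - (real m - ?h) * ((1 + \<kappa>) * a / m)
          = a / m * (?h - 3 * m * \<kappa> + ?h * \<kappa>)"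
        using m by (simp add: field_simps)
      \<comment> \<open>Here \<open>?h\<close> is at least 1, so the additive loss 3 m \<kappa> is
        at most a multiplicative one.\<close>
      moreover have "?h * (1 / D) \<le> ?h - 3 * m * \<kappa> + ?h * \<kappa>"
      proof -
        have "?h * (1 / D) \<le> ?h * (1 - 3 * m * \<kappa>)" using \<kappa>m by (intro mult_left_mono) auto
        also have "\<dots> = ?h - ?h * (3 * m * \<kappa>)" by (simp add: algebra_simps)
        also have "1 * (3 * m * \<kappa>) \<le> ?h * (3 * m * \<kappa>)"
          using False \<kappa> by (intro mult_right_mono) auto
        then have "?h - ?h * (3 * m * \<kappa>) \<le> ?h - 3 * m * \<kappa>" by simp
        also have "\<dots> \<le> ?h - 3 * m * \<kappa> + ?h * \<kappa>" using \<kappa> by simp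
        finally show ?thesis .
      qed
      then have "a / m * (?h * (1 / D)) \<le> a / m * (?h - 3 * m * \<kappa> + ?h * \<kappa>)"
        using a by (intro mult_left_mono) auto
      ultimately show ?thesis using ham_eq[OF ed] by (simp add: mult.commute)
    qed
    from lower upper show "a / D * ham m e d \<le> \<rho> e d \<and> \<rho> e d \<le> a * D * ham m e d" by simp
  qed
qed

section \<open>Averages over random flips\<close>

text \<open>For a uniform permutation the image of \<open>A\<close> is a uniformly random set of its
  size, so this is an average up to the factor n! 2^n. Summing over permutations rather than sets
  allows several blocks to be randomised jointly.\<close>

definition flip_sum :: "nat \<Rightarrow> ((nat \<Rightarrow> bool) \<Rightarrow> (nat \<Rightarrow> bool) \<Rightarrow> real) \<Rightarrow> nat set \<Rightarrow> real" where
  "flip_sum n w A = (\<Sum>\<pi> | \<pi> permutes {..<n}. \<Sum>e\<in>cube n. w e (flip_on (\<pi> ` A) e))"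

text \<open>Right composition with a permutation carrying A to B merely reindexes the sum.\<close>

lemma flip_sum_eq_of_card_eq:
  assumes "A \<subseteq> {..<n}" "B \<subseteq> {..<n}" "card A = card B"
  shows "flip_sum n w A = flip_sum n w B"
proof -
  obtain \<tau> where \<tau>: "\<tau> permutes {..<n}" "\<tau> ` A = B"
    by (rule ex_permutes_chain[of "{..<n}" A "{..<n}" B "{..<n}"]) (use assms in auto)
  show ?thesis
    unfolding flip_sum_def \<tau>(2)[symmetric]
    by (subst sum_permutations_compose_right[OF \<tau>(1)]) (simp add: image_comp)
qed

text \<open>For each permutation, flipping the image of A is a bijection of the cube, so the first
  vertex can be taken as the new base point; the second then differs from it on the image of the
  symmetric difference.\<close>

lemma flip_sum_shift:
  assumes "A \<subseteq> {..<n}" "B \<subseteq> {..<n}"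
  shows "(\<Sum>\<pi> | \<pi> permutes {..<n}. \<Sum>e\<in>cube n. w (flip_on (\<pi> ` A) e) (flip_on (\<pi> ` B) e))
    = flip_sum n w (sym_diff A B)"
  unfolding flip_sum_def
proof (rule sum.cong[OF HOL.refl])
  fix \<pi> assume "\<pi> \<in> {\<pi>. \<pi> permutes {..<n}}"
  then have \<pi>: "\<pi> permutes {..<n}" by simp
  have sub: "\<pi> ` A \<subseteq> {..<n}" using assms permutes_image[OF \<pi>] by blast
  have inj: "inj \<pi>" using \<pi> by (rule permutes_inj)
  have "flip_on (\<pi> ` sym_diff A B) (flip_on (\<pi> ` A) e) = flip_on (\<pi> ` B) e" for e
    unfolding flip_on_twice
    by (rule arg_cong[where f = "\<lambda>S. flip_on S e"]) (use inj in \<open>auto dest: injD\<close>)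
  then show "(\<Sum>e\<in>cube n. w (flip_on (\<pi> ` A) e) (flip_on (\<pi> ` B) e))
      = (\<Sum>e\<in>cube n. w e (flip_on (\<pi> ` sym_diff A B) e))"
    using sum.reindex_bij_betw[OF bij_betw_flip_on[OF sub], of "\<lambda>e. w e (flip_on (\<pi> ` sym_diff A B) e)"]
    by simp
qed

section \<open>Random grids of blocks\<close>

lemma card_div_preimage:
  assumes "finite T" "0 < k"
  shows "card {i. i div k \<in> T} = k * card T"
proof -
  have "card {i. i div k \<in> T} = k * card T \<and> finite {i. i div k \<in> T}"
    using assms(1)
  proof (induction T rule: finite_induct)
    case empty
    then show ?case by simp
  next
    case (insert t T)
    have "{i. i div k = t} = {t * k..<Suc t * k}"
      using assms(2) by (auto simp: div_nat_eqI dividend_less_times_div mult.commute)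
    then have "card {i. i div k = t} = k" "finite {i. i div k = t}" by auto
    moreover have "{i. i div k \<in> insert t T} = {i. i div k = t} \<union> {i. i div k \<in> T}" by auto
    moreover have "{i. i div k = t} \<inter> {i. i div k \<in> T} = {}" using insert by auto
    ultimately show ?case using insert by (simp add: card_Un_disjoint)
  qed
  then show ?thesis ..
qed

text \<open>\<open>grid k \<pi> e\<close> embeds the \<open>m\<close>-cube into the \<open>n\<close>-cube around \<open>e\<close>: coordinate \<open>i\<close> flips the block
  \<open>\<pi> ` {i * k..<(i + 1) * k}\<close>.\<close>

definition grid :: "nat \<Rightarrow> (nat \<Rightarrow> nat) \<Rightarrow> (nat \<Rightarrow> bool) \<Rightarrow> (nat \<Rightarrow> bool) \<Rightarrow> nat \<Rightarrow> bool" where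
  "grid k \<pi> e x = flip_on (\<pi> ` {i. x (i div k)}) e"

lemma block_subset:
  assumes "x \<in> cube m" "0 < k" "m * k \<le> n"
  shows "{i. x (i div k)} \<subseteq> {..<n}"
proof
  fix i assume "i \<in> {i. x (i div k)}"
  then have "i div k < m" using assms(1) by (auto intro: in_cube_imp_less)
  then have "i < m * k" using assms by (simp add: less_mult_imp_div_less div_less_iff_less_mult)
  then show "i \<in> {..<n}" using assms by simp
qed

lemma grid_in_cube:
  assumes "\<pi> permutes {..<n}" "e \<in> cube n" "x \<in> cube m" "0 < k" "m * k \<le> n"
  shows "grid k \<pi> e x \<in> cube n"
  unfolding grid_def using assms(2) block_subset[OF assms(3-5)] permutes_image[OF assms(1)]
  by (intro flip_on_in_cube) auto

text \<open>Two grid points differ exactly on the blocks of the coordinates where \<open>x\<close>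
  and \<open>y\<close> differ. Averaged over all grids, they become a random pair of the big cube
  that differs in \<open>k\<close> times as many coordinates.\<close>

lemma grid_sum:
  assumes "x \<in> cube m" "y \<in> cube m" "0 < k" "m * k \<le> n"
  shows "(\<Sum>\<pi> | \<pi> permutes {..<n}. \<Sum>e\<in>cube n. w (grid k \<pi> e x) (grid k \<pi> e y))
    = flip_sum n w {..<k * card {i. x i \<noteq> y i}}"
proof -
  let ?A = "{i. x (i div k)}" and ?B = "{i. y (i div k)}"
  have fin: "finite {i. x i \<noteq> y i}"
    using differ_subset[OF assms(1,2)] by (rule finite_subset) simp
  have "card {i. x i \<noteq> y i} \<le> m" using card_mono[OF _ differ_subset[OF assms(1,2)]] by simp
  then have "k * card {i. x i \<noteq> y i} \<le> n"
    using assms(4) by (metis mult.commute mult_le_mono2 order_trans)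
  then have sub: "{..<k * card {i. x i \<noteq> y i}} \<subseteq> {..<n}" by auto
  have eq: "sym_diff ?A ?B = {i. i div k \<in> {i. x i \<noteq> y i}}" by auto
  have "card (sym_diff ?A ?B) = k * card {i. x i \<noteq> y i}"
    unfolding eq by (rule card_div_preimage[OF fin assms(3)])
  moreover have "sym_diff ?A ?B \<subseteq> {..<n}"
    using block_subset[OF assms(1,3,4)] block_subset[OF assms(2,3,4)] by auto
  ultimately have "flip_sum n w (sym_diff ?A ?B) = flip_sum n w {..<k * card {i. x i \<noteq> y i}}"
    using sub by (intro flip_sum_eq_of_card_eq) auto
  then show ?thesis
    unfolding grid_def
    using flip_sum_shift[OF block_subset[OF assms(1,3,4)] block_subset[OF assms(2,3,4)], of w] by simp
qed

text \<open>Up to the factor \<open>n! * 2 ^ n\<close>, this is the \<open>p\<close>-th moment of \<open>\<rho> / k\<close> for a uniformly random pair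
  of vertices differing in exactly \<open>k\<close> coordinates.\<close>

definition rate :: "nat \<Rightarrow> ((nat \<Rightarrow> bool) \<Rightarrow> (nat \<Rightarrow> bool) \<Rightarrow> real) \<Rightarrow> real \<Rightarrow> nat \<Rightarrow> real" where
  "rate n \<rho> p k = flip_sum n (\<lambda>e d. \<rho> e d powr p) {..<k} / real k powr p"

lemma rate_nonneg: "0 \<le> rate n \<rho> p k"
  unfolding rate_def flip_sum_def by (intro divide_nonneg_nonneg sum_nonneg) auto

lemma flip_sum_eq_rate: "0 < k \<Longrightarrow> flip_sum n (\<lambda>e d. \<rho> e d powr p) {..<k} = real k powr p * rate n \<rho> p k"
  by (simp add: rate_def)

text \<open>Each of the m steps of a walk flips one block of size k, and the whole walk flips m k
  coordinates. The factor m^(p-1) times m steps of weight k^p gives (m k)^p, so the average defect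
  measures the drop in rate from scale k to scale m k.\<close>

lemma grid_defect_sum:
  assumes "x \<in> cube m" "\<sigma> permutes {..<m}" "0 < m" "0 < k" "m * k \<le> n"
  shows "(\<Sum>\<pi> | \<pi> permutes {..<n}. \<Sum>e\<in>cube n.
      defect p m (\<lambda>u v. \<rho> (grid k \<pi> e u) (grid k \<pi> e v)) x \<sigma>)
    = real (m * k) powr p * (rate n \<rho> p k - rate n \<rho> p (m * k))"
proof -
  let ?w = "\<lambda>e d. \<rho> e d powr p"
  have step: "(\<Sum>\<pi> | \<pi> permutes {..<n}. \<Sum>e\<in>cube n.
      ?w (grid k \<pi> e (walk \<sigma> x j)) (grid k \<pi> e (walk \<sigma> x (Suc j)))) = real k powr p * rate n \<rho> p k"
    if "j < m" for j
  proof -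
    have "{i. walk \<sigma> x j i \<noteq> walk \<sigma> x (Suc j) i} = {\<sigma> j}"
      unfolding walk_Suc[OF assms(2)] by (auto simp: cflip_def)
    then show ?thesis
      using grid_sum[of "walk \<sigma> x j" m "walk \<sigma> x (Suc j)" k n ?w] assms that
        walk_in_cube[OF assms(2,1)] flip_sum_eq_rate[of k n \<rho> p]
      by simp
  qed
  have "{i. x i \<noteq> cneg m x i} = {..<m}" by (auto simp: cneg_def)
  then have total: "(\<Sum>\<pi> | \<pi> permutes {..<n}. \<Sum>e\<in>cube n.
      ?w (grid k \<pi> e x) (grid k \<pi> e (cneg m x))) = real (m * k) powr p * rate n \<rho> p (m * k)"
    using grid_sum[of x m "cneg m x" k n ?w] assms cneg_in_cube[OF assms(1)]
      flip_sum_eq_rate[of "m * k" n \<rho> p]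
    by (simp add: mult.commute)
  have "(\<Sum>\<pi> | \<pi> permutes {..<n}. \<Sum>e\<in>cube n. \<Sum>j<m.
      ?w (grid k \<pi> e (walk \<sigma> x j)) (grid k \<pi> e (walk \<sigma> x (Suc j))))
    = (\<Sum>j<m. \<Sum>\<pi> | \<pi> permutes {..<n}. \<Sum>e\<in>cube n.
      ?w (grid k \<pi> e (walk \<sigma> x j)) (grid k \<pi> e (walk \<sigma> x (Suc j))))"
    by (subst sum.swap, subst sum.swap) (rule HOL.refl)
  also have "\<dots> = real m * (real k powr p * rate n \<rho> p k)" by (simp add: step)
  finally show ?thesis
    unfolding defect_def sum_subtractf total sum_distrib_left[symmetric]
    using assms by (simp add: powr_mult powr_diff algebra_simps)
qed

context cube_pmetric
begin

lemma pullback: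
  assumes "\<phi> \<in> cube m \<rightarrow> cube n"
  shows "cube_pmetric m (\<lambda>x y. \<rho> (\<phi> x) (\<phi> y))"
  by unfold_locales (rule nonneg refl commute triangle; use assms in auto)+

text \<open>The path through the vertex with the first k images flipped has steps of sizes k and l.
  With these sizes as weights in the power mean inequality, the powers of k and l reduce to the
  factors k and l.\<close>

lemma rate_subadditive:
  assumes "1 < p" "0 < k" "0 < l" "k + l \<le> n"
  shows "real (k + l) * rate n \<rho> p (k + l) \<le> real k * rate n \<rho> p k + real l * rate n \<rho> p l"
proof -
  let ?w = "\<lambda>e d. \<rho> e d powr p"
  let ?P = "{\<pi>. \<pi> permutes {..<n}}"
  have "flip_sum n ?w {..<k + l} \<le> (\<Sum>\<pi>\<in>?P. \<Sum>e\<in>cube n. real (k + l) powr (p - 1) *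
      (real k powr (1 - p) * ?w e (flip_on (\<pi> ` {..<k}) e) +
       real l powr (1 - p) * ?w (flip_on (\<pi> ` {..<k}) e) (flip_on (\<pi> ` {..<k + l}) e)))"
    unfolding flip_sum_def
  proof (intro sum_mono)
    fix \<pi> e assume "\<pi> \<in> ?P" and e: "e \<in> cube n"
    then have sub: "\<pi> ` {..<j} \<subseteq> {..<n}" if "j \<le> n" for j
      using that permutes_image[of \<pi> "{..<n}"] by force
    let ?a = "flip_on (\<pi> ` {..<k}) e" and ?b = "flip_on (\<pi> ` {..<k + l}) e"
    have ab: "?a \<in> cube n" "?b \<in> cube n" using sub assms e by (simp_all add: flip_on_in_cube)
    \<comment> \<open>The two steps of the path are indexed by the Booleans, \<open>True\<close>
      being the first step.\<close>
    have "\<rho> e ?b powr p \<le> (\<Sum>i\<in>{False, True}. real (if i then k else l)) powr (p - 1) *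
        (\<Sum>i\<in>{False, True}. real (if i then k else l) powr (1 - p) *
           (if i then \<rho> e ?a else \<rho> ?a ?b) powr p)"
      using assms nonneg[OF e ab(1)] nonneg[OF e ab(2)] nonneg[OF ab] triangle[OF e ab]
      by (intro weighted_power_mean) auto
    then show "?w e ?b \<le> real (k + l) powr (p - 1) *
       (real k powr (1 - p) * ?w e ?a + real l powr (1 - p) * ?w ?a ?b)"
      by (simp add: add.commute)
  qed
  also have "\<dots> = real (k + l) powr (p - 1) * (real k powr (1 - p) * flip_sum n ?w {..<k} +
      real l powr (1 - p) * flip_sum n ?w (sym_diff {..<k} {..<k + l}))"
    using assms flip_sum_shift[of "{..<k}" n "{..<k + l}" ?w]
    by (simp add: sum.distrib sum_distrib_left[symmetric] flip_sum_def)
  also have "flip_sum n ?w (sym_diff {..<k} {..<k + l}) = flip_sum n ?w {..<l}"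
  proof (rule flip_sum_eq_of_card_eq)
    have "sym_diff {..<k} {..<k + l} = {k..<k + l}" by auto
    then show "card (sym_diff {..<k} {..<k + l}) = card {..<l}" "sym_diff {..<k} {..<k + l} \<subseteq> {..<n}"
      using assms by auto
  qed (use assms in auto)
  finally have "real (k + l) powr p * rate n \<rho> p (k + l) \<le> real (k + l) powr (p - 1) *
      (real k * rate n \<rho> p k + real l * rate n \<rho> p l)"
    using assms by (simp add: flip_sum_eq_rate powr_diff del: of_nat_add)
  moreover have "real (k + l) powr p = real (k + l) powr (p - 1) * real (k + l)"
    using assms by (simp add: powr_diff del: of_nat_add)
  ultimately show ?thesis using assms by (simp add: mult.assoc del: of_nat_add)
qed

lemma rate_mult_le:
  assumes "1 < p" "0 < k" "0 < m" "m * k \<le> n"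
  shows "rate n \<rho> p (m * k) \<le> rate n \<rho> p k"
proof -
  have "0 < m \<Longrightarrow> m * k \<le> n \<Longrightarrow> real (m * k) * rate n \<rho> p (m * k) \<le> real (m * k) * rate n \<rho> p k"
  proof (induction m)
    case (Suc m)
    show ?case
    proof (cases "m = 0")
      case False
      have "real (m * k + k) * rate n \<rho> p (m * k + k) \<le> real (m * k) * rate n \<rho> p (m * k) + real k * rate n \<rho> p k"
        using Suc.prems False assms by (intro rate_subadditive) auto
      moreover have "real (m * k) * rate n \<rho> p (m * k) \<le> real (m * k) * rate n \<rho> p k"
        using Suc False by auto
      ultimately show ?thesis by (simp add: algebra_simps)
    qed simp
  qed simp
  then show ?thesis using assms by simp
qed

lemma rate_le_rate_1: "\<lbrakk>1 < p; 0 < k; k \<le> n\<rbrakk> \<Longrightarrow> rate n \<rho> p k \<le> rate n \<rho> p 1"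
  using rate_mult_le[of p 1 k] by simp

end

lemma rate_le_scaled_rate:
  assumes "cube_pmetric n \<rho>X" "cube_pmetric n \<rho>Y" "0 < lam" "0 < p" "k \<le> n"
    and "\<And>e d. \<lbrakk>e \<in> cube n; d \<in> cube n\<rbrakk> \<Longrightarrow> \<rho>Y e d \<le> lam * \<rho>X e d"
  shows "rate n \<rho>Y p k \<le> lam powr p * rate n \<rho>X p k"
proof -
  interpret X: cube_pmetric n \<rho>X by fact
  interpret Y: cube_pmetric n \<rho>Y by fact
  have "flip_sum n (\<lambda>e d. \<rho>Y e d powr p) {..<k}
      \<le> (\<Sum>\<pi> | \<pi> permutes {..<n}. \<Sum>e\<in>cube n. lam powr p * \<rho>X e (flip_on (\<pi> ` {..<k}) e) powr p)"
    unfolding flip_sum_def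
  proof (intro sum_mono)
    fix \<pi> e assume "\<pi> \<in> {\<pi>. \<pi> permutes {..<n}}" and e: "e \<in> cube n"
    then have d: "flip_on (\<pi> ` {..<k}) e \<in> cube n"
      using assms(5) permutes_image[of \<pi> "{..<n}"] by (intro flip_on_in_cube) force+
    have "\<rho>Y e (flip_on (\<pi> ` {..<k}) e) powr p \<le> (lam * \<rho>X e (flip_on (\<pi> ` {..<k}) e)) powr p"
      using assms e d Y.nonneg by (intro powr_mono2) auto
    then show "\<rho>Y e (flip_on (\<pi> ` {..<k}) e) powr p \<le> lam powr p * \<rho>X e (flip_on (\<pi> ` {..<k}) e) powr p"
      using assms X.nonneg[OF e d] by (simp add: powr_mult)
  qed
  also have "\<dots> = lam powr p * flip_sum n (\<lambda>e d. \<rho>X e d powr p) {..<k}"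
    by (simp add: flip_sum_def sum_distrib_left)
  finally show ?thesis
    unfolding rate_def using divide_right_mono by fastforce
qed

section \<open>Extraction of nearly isometric cubes\<close>

lemma telescoping_pigeonhole:
  fixes h :: "nat \<Rightarrow> real"
  assumes "0 < L" "h 0 - h L \<le> C"
  obtains j where "j < L" "h j - h (Suc j) \<le> C / L"
proof (rule ccontr)
  assume "\<not> thesis"
  with that have "C / L < h j - h (Suc j)" if "j < L" for j using that by force
  then have "(\<Sum>j<L. C / L) < (\<Sum>j<L. h j - h (Suc j))"
    using assms(1) by (intro sum_strict_mono) auto
  also have "\<dots> = h 0 - h L" by (rule sum_lessThan_telescope')
  finally show False using assms by simp
qed

text \<open>\<open>N\<close> depends on the parameters but not on the pseudometrics, and the lower
  bound for b / a involves neither \<open>m\<close> nor \<open>D\<close>; this uniformity permits a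
  single constant \<open>c\<close> for all cubes and all distortions.\<close>

lemma large_rate_ratio_gives_cube:
  fixes p lam \<beta> D :: real
  assumes p: "1 < p" and lam: "0 < lam" and \<beta>: "0 < \<beta>" and m: "0 < m" and D: "1 < D"
  obtains N where "\<And>n \<rho>X \<rho>Y. \<lbrakk>N \<le> n; cube_pmetric n \<rho>X; cube_pmetric n \<rho>Y;
      \<And>e d. \<lbrakk>e \<in> cube n; d \<in> cube n\<rbrakk> \<Longrightarrow> \<rho>Y e d \<le> lam * \<rho>X e d;
      \<beta> powr p * rate n \<rho>X p 1 < rate n \<rho>Y p n\<rbrakk> \<Longrightarrow>
    \<exists>\<phi> a b. \<phi> \<in> cube m \<rightarrow> cube n \<and> 0 < a \<and> 0 < b \<and> a * (\<beta> powr p / 4) powr (1 / p) \<le> b \<and>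
      (\<forall>x\<in>cube m. \<forall>y\<in>cube m.
        a / D * ham m x y \<le> \<rho>X (\<phi> x) (\<phi> y) \<and> \<rho>X (\<phi> x) (\<phi> y) \<le> a * D * ham m x y \<and>
        b / D * ham m x y \<le> \<rho>Y (\<phi> x) (\<phi> y) \<and> \<rho>Y (\<phi> x) (\<phi> y) \<le> b * D * ham m x y)"
proof -
  obtain \<xi> where \<xi>: "0 < \<xi>" and rigid:
    "\<And>\<rho> a e d. \<lbrakk>cube_pmetric m \<rho>; a = \<rho> (\<lambda>_. False) (cneg m (\<lambda>_. False)); 0 < a;
       \<And>e \<sigma>. \<lbrakk>e \<in> cube m; \<sigma> permutes {..<m}\<rbrakk> \<Longrightarrow> defect p m \<rho> e \<sigma> \<le> \<xi> * a powr p;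
       e \<in> cube m; d \<in> cube m\<rbrakk>
     \<Longrightarrow> a / D * ham m e d \<le> \<rho> e d \<and> \<rho> e d \<le> a * D * ham m e d"
    by (rule small_defect_rigidity[OF p m D]) blast
  \<comment> \<open>One factor 2 is lost in passing from \<open>n\<close> to the multiple
    \<open>q * Q\<close>, another because the average of \<open>\<Phi>\<close> must pay for two
    subtracted terms.\<close>
  define \<gamma> where "\<gamma> = \<beta> powr p / 4"
  \<comment> \<open>\<open>\<Lambda>\<close> bounds the total drop of both rates in units of the
    X-rate at scale 1 and, later, b^p in terms of a^p.\<close>
  define \<Lambda> where "\<Lambda> = 1 + lam powr p"
  define M where "M = \<Lambda> / \<xi>"
  define I where "I = cube m \<times> {\<sigma>. \<sigma> permutes {..<m}}"
  have finI: "finite I" unfolding I_def by (intro finite_cartesian_product finite_cube finite_permutations) simp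
  have \<gamma>: "0 < \<gamma>" using \<beta> by (simp add: \<gamma>_def)
  have \<Lambda>: "1 \<le> \<Lambda>" by (simp add: \<Lambda>_def)
  have M: "0 < M" using \<Lambda> \<xi> by (simp add: M_def)
  \<comment> \<open>With so many scales, the smallest drop among them is below \<gamma> times the
    X-rate at scale 1, even after multiplication by \<open>M * card I\<close>.\<close>
  obtain L0 :: nat where L0: "M * card I * \<Lambda> / \<gamma> < real L0" using reals_Archimedean2 by blast
  define L where "L = Suc L0"
  have L: "0 < L" "M * card I * \<Lambda> / L < \<gamma>"
    using L0 \<gamma> by (auto simp: L_def field_simps)
  define Q where "Q = m ^ L"
  have Q: "0 < Q" using m by (simp add: Q_def)
  \<comment> \<open>Beyond \<open>N0\<close>, the fewer than \<open>Q\<close> coordinates left over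
    when \<open>n\<close> is rounded down to a multiple of \<open>Q\<close> cost at most half of the
    lower bound on the Y-rate.\<close>
  obtain N0 :: nat where N0: "Q * lam powr p / (2 * \<gamma>) < real N0" using reals_Archimedean2 by blast
  show ?thesis
  proof (rule that[of "max Q N0"])
    fix n \<rho>X \<rho>Y
    assume n: "max Q N0 \<le> n" and "cube_pmetric n \<rho>X" "cube_pmetric n \<rho>Y"
      and lip: "\<And>e d. \<lbrakk>e \<in> cube n; d \<in> cube n\<rbrakk> \<Longrightarrow> \<rho>Y e d \<le> lam * \<rho>X e d"
      and big: "\<beta> powr p * rate n \<rho>X p 1 < rate n \<rho>Y p n"
    interpret X: cube_pmetric n \<rho>X by fact
    interpret Y: cube_pmetric n \<rho>Y by fact
    let ?X = "rate n \<rho>X p" and ?Y = "rate n \<rho>Y p"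
    define u where "u = ?X 1"
    have n0: "0 < n" using n Q by simp
    have YX: "?Y k \<le> lam powr p * ?X k" if "k \<le> n" for k
      using rate_le_scaled_rate[OF X.cube_pmetric_axioms Y.cube_pmetric_axioms lam _ that lip] p by simp
    have Y1: "?Y 1 \<le> lam powr p * u" using YX[of 1] n0 by (simp add: u_def)
    have u: "0 < u"
    proof (rule ccontr)
      assume "\<not> 0 < u"
      then have "u = 0" using rate_nonneg[of n \<rho>X p 1] by (simp add: u_def)
      with big Y1 Y.rate_le_rate_1[OF p, of n] n0 show False by (simp add: u_def)
    qed
    \<comment> \<open>The scales are q m^j. The last one, \<open>q * Q\<close>, is the largest
      multiple of \<open>Q\<close> up to \<open>n\<close>, and every scale divides it.\<close>
    define q where "q = n div Q"
    have q: "0 < q" "q * Q \<le> n" "n - q * Q < Q"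
      using n Q by (auto simp: q_def div_greater_zero_iff minus_mod_eq_div_mult[symmetric])
    have Ytop: "2 * \<gamma> * u \<le> ?Y (q * Q)"
    proof -
      have "real n * ?Y n \<le> real (q * Q) * ?Y (q * Q) + Q * (lam powr p * u)"
      proof (cases "n = q * Q")
        case True
        then show ?thesis using u by simp
      next
        case False
        define r where "r = n - q * Q"
        have r: "0 < r" "q * Q + r = n" "r < Q" using False q by (auto simp: r_def)
        have "real (q * Q + r) * ?Y (q * Q + r) \<le> real (q * Q) * ?Y (q * Q) + real r * ?Y r"
          using q Q r by (intro Y.rate_subadditive[OF p]) auto
        also have "real r * ?Y r \<le> Q * (lam powr p * u)"
          using r Y1 Y.rate_le_rate_1[OF p, of r] rate_nonneg by (intro mult_mono) auto
        finally show ?thesis by (simp add: r(2))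
      qed
      moreover have "real n * (4 * \<gamma> * u) \<le> real n * ?Y n"
        using big by (intro mult_left_mono) (auto simp: \<gamma>_def u_def)
      moreover have "Q * (lam powr p * u) \<le> real n * (2 * \<gamma> * u)"
      proof -
        have "Q * lam powr p / (2 * \<gamma>) \<le> real n" using N0 n by linarith
        then have "Q * lam powr p \<le> real n * (2 * \<gamma>)" using \<gamma> by (simp add: field_simps)
        then have "Q * lam powr p * u \<le> real n * (2 * \<gamma>) * u" using u by (intro mult_right_mono) auto
        then show ?thesis by (simp add: mult.assoc)
      qed
      ultimately have "real n * (2 * \<gamma> * u) \<le> real (q * Q) * ?Y (q * Q)" by (simp add: algebra_simps)
      moreover have "real (q * Q) * (2 * \<gamma> * u) \<le> real n * (2 * \<gamma> * u)"
        using q(2) \<gamma> u by (intro mult_right_mono) (auto simp flip: of_nat_mult)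
      ultimately have "real (q * Q) * (2 * \<gamma> * u) \<le> real (q * Q) * ?Y (q * Q)" by linarith
      then show ?thesis using q Q by simp
    qed
    \<comment> \<open>Adding the two rates lets one pigeonhole choose a scale that serves both
      pseudometrics.\<close>
    define h where "h j = ?X (q * m ^ j) + ?Y (q * m ^ j)" for j
    have qQ: "q \<le> n" using q Q by (metis le_trans less_one mult.right_neutral mult_le_mono2 not_le)
    have "h 0 - h L \<le> \<Lambda> * u"
      using X.rate_le_rate_1[OF p q(1) qQ] Y.rate_le_rate_1[OF p q(1) qQ] Y1
        rate_nonneg[of n \<rho>X p "q * m ^ L"] rate_nonneg[of n \<rho>Y p "q * m ^ L"]
      by (simp add: h_def \<Lambda>_def u_def algebra_simps)
    then obtain j where j: "j < L" "h j - h (Suc j) \<le> \<Lambda> * u / L"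
      using telescoping_pigeonhole[OF L(1)] by blast
    define k where "k = q * m ^ j"
    have k0: "0 < k" using q m by (simp add: k_def)
    have mk: "m * k = q * m ^ Suc j" by (simp add: k_def)
    have Qmk: "m ^ (L - Suc j) * (m * k) = q * Q"
      using j by (simp add: k_def Q_def mult.left_commute flip: power_add power_Suc)
    then have mkn: "m * k \<le> n" using q m by (metis le_trans mult.commute mult_le_mono2 nat_mult_1_right Suc_leI One_nat_def zero_less_power)
    \<comment> \<open>\<open>m * k\<close> divides \<open>q * Q\<close>, and rates do not increase
      in passing to a multiple.\<close>
    have "?Y (q * Q) \<le> ?Y (m * k)"
      using Y.rate_mult_le[OF p, of "m * k" "m ^ (L - Suc j)"] Qmk m k0 q by simp
    then have Ymk: "2 * \<gamma> * u \<le> ?Y (m * k)" using Ytop by simp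
    have Xmk: "?X (m * k) \<le> u" using X.rate_le_rate_1[OF p, of "m * k"] m k0 mkn by (simp add: u_def)
    have drop: "(?X k - ?X (m * k)) + (?Y k - ?Y (m * k)) \<le> \<Lambda> * u / L"
      using j(2) by (simp add: h_def k_def mult.left_commute)
    let ?z = "\<lambda>_::nat. False"
    let ?pX = "\<lambda>\<pi> e x y. \<rho>X (grid k \<pi> e x) (grid k \<pi> e y)"
    let ?pY = "\<lambda>\<pi> e x y. \<rho>Y (grid k \<pi> e x) (grid k \<pi> e y)"
    let ?dX = "\<lambda>\<pi> e (x, \<sigma>). defect p m (?pX \<pi> e) x \<sigma>"
    let ?dY = "\<lambda>\<pi> e (x, \<sigma>). defect p m (?pY \<pi> e) x \<sigma>"
    \<comment> \<open>A grid on which \<open>\<Phi>\<close> is positive has small defects relative to its diameters,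
      and its two diameters are comparable.\<close>
    define \<Phi> where "\<Phi> \<pi> e = ?pY \<pi> e ?z (cneg m ?z) powr p - \<gamma> * ?pX \<pi> e ?z (cneg m ?z) powr p
      - M * (\<Sum>i\<in>I. ?dX \<pi> e i + ?dY \<pi> e i)" for \<pi> e
    let ?S = "\<lambda>F. \<Sum>\<pi> | \<pi> permutes {..<n}. \<Sum>e\<in>cube n. F \<pi> e :: real"
    have "?S (\<lambda>\<pi> e. \<rho> (grid k \<pi> e ?z) (grid k \<pi> e (cneg m ?z)) powr p)
        = real (m * k) powr p * rate n \<rho> p (m * k)" for \<rho>
    proof -
      have "{i. ?z i \<noteq> cneg m ?z i} = {..<m}" by (auto simp: cneg_def)
      then show ?thesis
        using grid_sum[of ?z m "cneg m ?z" k n "\<lambda>e d. \<rho> e d powr p"] zero_in_cube cneg_in_cube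
          flip_sum_eq_rate[of "m * k" n \<rho> p] k0 m mkn
        by (simp add: mult.commute)
    qed
    moreover have "?S (\<lambda>\<pi> e. \<Sum>i\<in>I. ?dX \<pi> e i + ?dY \<pi> e i)
        = card I * (real (m * k) powr p * ((?X k - ?X (m * k)) + (?Y k - ?Y (m * k))))"
    proof -
      have "?S (\<lambda>\<pi> e. \<Sum>i\<in>I. ?dX \<pi> e i + ?dY \<pi> e i) = (\<Sum>i\<in>I. ?S (\<lambda>\<pi> e. ?dX \<pi> e i + ?dY \<pi> e i))"
        by (subst sum.swap, subst sum.swap) (rule HOL.refl)
      also have "\<dots> = (\<Sum>i\<in>I. real (m * k) powr p * ((?X k - ?X (m * k)) + (?Y k - ?Y (m * k))))"
      proof (rule sum.cong[OF HOL.refl])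
        fix i assume "i \<in> I"
        then obtain x \<sigma> where i: "i = (x, \<sigma>)" "x \<in> cube m" "\<sigma> permutes {..<m}" by (auto simp: I_def)
        show "?S (\<lambda>\<pi> e. ?dX \<pi> e i + ?dY \<pi> e i)
            = real (m * k) powr p * ((?X k - ?X (m * k)) + (?Y k - ?Y (m * k)))"
          unfolding sum.distrib i(1) case_prod_conv
          unfolding grid_defect_sum[OF i(2,3) m k0 mkn] by (simp only: distrib_left)
      qed
      finally show ?thesis by simp
    qed
    ultimately have "?S \<Phi> = real (m * k) powr p * (?Y (m * k) - \<gamma> * ?X (m * k)
        - M * card I * ((?X k - ?X (m * k)) + (?Y k - ?Y (m * k))))"
      unfolding \<Phi>_def sum_subtractf sum_distrib_left[symmetric]
      by (simp only: right_diff_distrib distrib_left mult.assoc mult.left_commute)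
    moreover have "0 < ?Y (m * k) - \<gamma> * ?X (m * k)
        - M * card I * ((?X k - ?X (m * k)) + (?Y k - ?Y (m * k)))"
    proof -
      have "M * card I * ((?X k - ?X (m * k)) + (?Y k - ?Y (m * k))) \<le> M * card I * (\<Lambda> * u / L)"
        using drop M by (intro mult_left_mono) auto
      also have "\<dots> = M * card I * \<Lambda> / L * u" by simp
      also have "\<dots> < \<gamma> * u" using L u by (intro mult_strict_right_mono)
      finally show ?thesis using Ymk mult_left_mono[OF Xmk, of \<gamma>] \<gamma> by linarith
    qed
    moreover have "0 < real (m * k) powr p" using m k0 by simp
    ultimately have "0 < ?S \<Phi>" by (metis mult_pos_pos)
    then have "\<exists>\<pi> e. \<pi> permutes {..<n} \<and> e \<in> cube n \<and> 0 < \<Phi> \<pi> e"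
      by (rule contrapos_pp) (auto simp: not_less intro!: sum_nonpos)
    then obtain \<pi> e where \<pi>: "\<pi> permutes {..<n}" and e: "e \<in> cube n" and \<Phi>: "0 < \<Phi> \<pi> e" by blast
    have grid: "grid k \<pi> e \<in> cube m \<rightarrow> cube n"
      using grid_in_cube[OF \<pi> e _ k0 mkn] by blast
    interpret GX: cube_pmetric m "?pX \<pi> e" using grid by (rule X.pullback)
    interpret GY: cube_pmetric m "?pY \<pi> e" using grid by (rule Y.pullback)
    define a where "a = ?pX \<pi> e ?z (cneg m ?z)"
    define b where "b = ?pY \<pi> e ?z (cneg m ?z)"
    have ab0: "0 \<le> a" "0 \<le> b"
      unfolding a_def b_def by (intro GX.nonneg GY.nonneg zero_in_cube cneg_in_cube)+
    have bla: "b \<le> lam * a"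
      unfolding a_def b_def using grid zero_in_cube cneg_in_cube[OF zero_in_cube] by (intro lip) auto
    have dnn: "0 \<le> ?dX \<pi> e i" "0 \<le> ?dY \<pi> e i" if "i \<in> I" for i
      using that GX.defect_nonneg[OF p] GY.defect_nonneg[OF p] by (auto simp: I_def)
    have "0 \<le> M * (\<Sum>i\<in>I. ?dX \<pi> e i + ?dY \<pi> e i)"
      using M dnn by (intro mult_nonneg_nonneg sum_nonneg add_nonneg_nonneg) auto
    \<comment> \<open>Discarding the nonnegative defect term leaves a comparison of the diameters,
      which makes \<open>b\<close> positive; the Lipschitz bound then makes \<open>a\<close>
      positive.\<close>
    then have ba: "\<gamma> * a powr p < b powr p" using \<Phi> by (simp add: \<Phi>_def a_def b_def)
    moreover have "0 \<le> \<gamma> * a powr p" using \<gamma> by simp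
    ultimately have b: "0 < b" using ab0 by (cases "b = 0") auto
    then have a: "0 < a" using bla lam ab0 by (cases "a = 0") auto
    have "(a * \<gamma> powr (1 / p)) powr p < b powr p"
      using ba a \<gamma> p by (simp add: powr_mult powr_powr mult.commute)
    then have ratio: "a * \<gamma> powr (1 / p) \<le> b"
      using powr_mono2[of p b "a * \<gamma> powr (1 / p)"] p b by linarith
    have dle: "M * (?dX \<pi> e i + ?dY \<pi> e i) \<le> b powr p" if "i \<in> I" for i
    proof -
      have "?dX \<pi> e i + ?dY \<pi> e i \<le> (\<Sum>i\<in>I. ?dX \<pi> e i + ?dY \<pi> e i)"
        using dnn finI that by (intro member_le_sum add_nonneg_nonneg) auto
      then have "M * (?dX \<pi> e i + ?dY \<pi> e i) \<le> M * (\<Sum>i\<in>I. ?dX \<pi> e i + ?dY \<pi> e i)"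
        using M by (intro mult_left_mono) auto
      then show ?thesis using \<Phi> \<open>0 \<le> \<gamma> * a powr p\<close> by (simp add: \<Phi>_def a_def b_def)
    qed
    have dY: "defect p m (?pY \<pi> e) x \<sigma> \<le> \<xi> * b powr p"
      and dX: "defect p m (?pX \<pi> e) x \<sigma> \<le> \<xi> * a powr p"
      if "x \<in> cube m" "\<sigma> permutes {..<m}" for x \<sigma>
    proof -
      have i: "(x, \<sigma>) \<in> I" using that by (simp add: I_def)
      have bp: "b powr p \<le> \<Lambda> * b powr p" "b powr p \<le> \<Lambda> * a powr p"
      proof -
        show "b powr p \<le> \<Lambda> * b powr p" using mult_right_mono[OF \<Lambda>, of "b powr p"] by simp
        have "b powr p \<le> (lam * a) powr p" using bla b p by (intro powr_mono2) auto
        also have "\<dots> = lam powr p * a powr p" using lam a by (simp add: powr_mult)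
        also have "\<dots> \<le> \<Lambda> * a powr p" by (intro mult_right_mono) (auto simp: \<Lambda>_def)
        finally show "b powr p \<le> \<Lambda> * a powr p" .
      qed
      \<comment> \<open>Since M = \<Lambda> / \<xi>, the hypothesis says that \<Lambda> d is at most
        \<xi> b^p, and b^p is at most \<Lambda> times either of a^p and b^p.\<close>
      have *: "d \<le> \<xi> * b powr p \<and> d \<le> \<xi> * a powr p" if "M * d \<le> b powr p" for d
      proof -
        have "\<Lambda> * d \<le> \<xi> * b powr p" using that \<xi> by (simp add: M_def field_simps)
        moreover have "\<xi> * b powr p \<le> \<xi> * (\<Lambda> * b powr p)" "\<xi> * b powr p \<le> \<xi> * (\<Lambda> * a powr p)"
          using bp \<xi> by (auto intro: mult_left_mono)
        ultimately have "\<Lambda> * d \<le> \<Lambda> * (\<xi> * b powr p)" "\<Lambda> * d \<le> \<Lambda> * (\<xi> * a powr p)"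
          unfolding mult.left_commute[of \<Lambda>] by linarith+
        then show ?thesis using \<Lambda> by simp
      qed
      have "M * defect p m (?pY \<pi> e) x \<sigma> \<le> b powr p" "M * defect p m (?pX \<pi> e) x \<sigma> \<le> b powr p"
        using dle[OF i] dnn[OF i] M by (auto simp: distrib_left intro: order_trans[rotated])
      with * show "defect p m (?pY \<pi> e) x \<sigma> \<le> \<xi> * b powr p" "defect p m (?pX \<pi> e) x \<sigma> \<le> \<xi> * a powr p"
        by blast+
    qed
    have "a / D * ham m x y \<le> ?pX \<pi> e x y \<and> ?pX \<pi> e x y \<le> a * D * ham m x y"
      "b / D * ham m x y \<le> ?pY \<pi> e x y \<and> ?pY \<pi> e x y \<le> b * D * ham m x y"
      if "x \<in> cube m" "y \<in> cube m" for x y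
      using rigid[OF GX.cube_pmetric_axioms a_def a dX that] rigid[OF GY.cube_pmetric_axioms b_def b dY that]
      by auto
    with grid a b ratio show "\<exists>\<phi> a b. \<phi> \<in> cube m \<rightarrow> cube n \<and> 0 < a \<and> 0 < b \<and>
      a * (\<beta> powr p / 4) powr (1 / p) \<le> b \<and>
      (\<forall>x\<in>cube m. \<forall>y\<in>cube m.
        a / D * ham m x y \<le> \<rho>X (\<phi> x) (\<phi> y) \<and> \<rho>X (\<phi> x) (\<phi> y) \<le> a * D * ham m x y \<and>
        b / D * ham m x y \<le> \<rho>Y (\<phi> x) (\<phi> y) \<and> \<rho>Y (\<phi> x) (\<phi> y) \<le> b * D * ham m x y)"
      by (intro exI[of _ "grid k \<pi> e"] exI[of _ a] exI[of _ b]) (auto simp: \<gamma>_def)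
  qed
qed

section \<open>The constants of a collection of Lipschitz maps\<close>

lemma flip_sum_full: "flip_sum n w {..<n} = fact n * (\<Sum>e\<in>cube n. w e (cneg n e))"
proof -
  have "flip_sum n w {..<n} = (\<Sum>\<pi> | \<pi> permutes {..<n}. \<Sum>e\<in>cube n. w e (cneg n e))"
    unfolding flip_sum_def by (intro sum.cong HOL.refl) (auto simp: permutes_image cneg_eq_flip_on)
  then show ?thesis by (simp add: card_permutations)
qed

text \<open>Replacing position 0 by every position in turn and then reindexing by the permutation
  turns a random single flip into a sum over all edge directions.\<close>

lemma flip_sum_single:
  assumes "0 < n"
  shows "real n * flip_sum n w {..<1} = fact n * (\<Sum>i<n. \<Sum>e\<in>cube n. w e (cflip i e))"
proof -
  have "real n * flip_sum n w {..<1} = (\<Sum>i<n. flip_sum n w {..<1})" by simp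
  also have "\<dots> = (\<Sum>i<n. flip_sum n w {i})"
    using assms by (intro sum.cong flip_sum_eq_of_card_eq) auto
  also have "\<dots> = (\<Sum>\<pi> | \<pi> permutes {..<n}. \<Sum>i<n. \<Sum>e\<in>cube n. w e (cflip (\<pi> i) e))"
    unfolding flip_sum_def by (subst sum.swap) (simp add: cflip_eq_flip_on)
  also have "\<dots> = (\<Sum>\<pi> | \<pi> permutes {..<n}. \<Sum>i<n. \<Sum>e\<in>cube n. w e (cflip i e))"
  proof (rule sum.cong[OF HOL.refl])
    fix \<pi> assume "\<pi> \<in> {\<pi>. \<pi> permutes {..<n}}"
    then have "bij_betw \<pi> {..<n} {..<n}" by (simp add: permutes_imp_bij)
    from sum.reindex_bij_betw[OF this, of "\<lambda>i. \<Sum>e\<in>cube n. w e (cflip i e)"]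
    show "(\<Sum>i<n. \<Sum>e\<in>cube n. w e (cflip (\<pi> i) e)) = (\<Sum>i<n. \<Sum>e\<in>cube n. w e (cflip i e))" .
  qed
  also have "\<dots> = fact n * (\<Sum>i<n. \<Sum>e\<in>cube n. w e (cflip i e))"
    by (simp add: card_permutations)
  finally show ?thesis .
qed

text \<open>Both sides are scaled by \<open>fact n * card (cube n)\<close> over n^p. The factor
  n^(p-1) with the sum over n directions is exactly the normalisation of the rate at scale 1, so the
  inequality compares the extreme scales n and 1.\<close>

lemma cexp_le_iff_rate_le:
  assumes "0 < n"
  shows "cexp n (\<lambda>e. \<rho>Y e (cneg n e) powr p)
      \<le> C * real n powr (p - 1) * (\<Sum>i<n. cexp n (\<lambda>e. \<rho>X e (cflip i e) powr p))
    \<longleftrightarrow> rate n \<rho>Y p n \<le> C * rate n \<rho>X p 1"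
proof -
  define K :: real where "K = fact n * card (cube n)"
  have K: "0 < K" using card_cube_pos[of n] by (simp add: K_def)
  let ?y = "cexp n (\<lambda>e. \<rho>Y e (cneg n e) powr p)"
  let ?x = "\<Sum>i<n. cexp n (\<lambda>e. \<rho>X e (cflip i e) powr p)"
  have "flip_sum n (\<lambda>e d. \<rho>Y e d powr p) {..<n} = K * ?y"
    using card_cube_pos[of n] by (simp add: flip_sum_full K_def cexp_def)
  then have y: "rate n \<rho>Y p n = K / real n powr p * ?y" by (simp add: rate_def)
  have "real n * flip_sum n (\<lambda>e d. \<rho>X e d powr p) {..<1} = K * ?x"
    unfolding flip_sum_single[OF assms]
    using card_cube_pos[of n] by (simp add: K_def cexp_def sum_divide_distrib[symmetric])
  then have x: "C * rate n \<rho>X p 1 = K / real n powr p * (C * real n powr (p - 1) * ?x)"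
    using assms by (simp add: rate_def powr_diff field_simps)
  show ?thesis
    unfolding x y using K assms by (subst mult_le_cancel_left_pos) auto
qed

section \<open>Averages and Lipschitz constants on the cube\<close>

lemma cexp_le: "(\<And>e. e \<in> cube n \<Longrightarrow> g e \<le> C) \<Longrightarrow> cexp n g \<le> C"
  using sum_bounded_above[of "cube n" g C] card_cube_pos[of n]
  by (simp add: cexp_def divide_le_eq mult.commute)

lemma cexp_ge: "(\<And>e. e \<in> cube n \<Longrightarrow> C \<le> g e) \<Longrightarrow> C \<le> cexp n g"
  using sum_bounded_below[of "cube n" C g] card_cube_pos[of n]
  by (simp add: cexp_def le_divide_eq mult.commute)

text \<open>Jensen's inequality, obtained from the power mean inequality with unit weights on the
  vertices.\<close>

lemma cexp_powr_le:
  fixes p :: real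
  assumes "1 < p" "\<And>e. e \<in> cube n \<Longrightarrow> 0 \<le> g e"
  shows "cexp n g powr p \<le> cexp n (\<lambda>e. g e powr p)"
proof -
  let ?N = "real (card (cube n))"
  have N: "0 < ?N" using card_cube_pos[of n] by simp
  have "(\<Sum>e\<in>cube n. g e) powr p \<le> ?N powr (p - 1) * (\<Sum>e\<in>cube n. g e powr p)"
    using weighted_power_mean[of p "cube n" "\<lambda>_. 1" g "\<Sum>e\<in>cube n. g e"] assms finite_cube
    by (simp add: sum_nonneg)
  then have "(\<Sum>e\<in>cube n. g e) powr p / ?N powr p \<le> ?N powr (p - 1) * (\<Sum>e\<in>cube n. g e powr p) / ?N powr p"
    by (intro divide_right_mono) auto
  then show ?thesis
    using N assms by (simp add: cexp_def powr_divide sum_nonneg powr_diff field_simps)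
qed

lemma edge_energy_le:
  fixes p :: real
  assumes "1 < p" "0 < n" "0 \<le> E"
    and "\<And>e i. \<lbrakk>e \<in> cube n; i < n\<rbrakk> \<Longrightarrow> 0 \<le> \<rho> e (cflip i e) \<and> \<rho> e (cflip i e) \<le> E / n"
  shows "real n powr (p - 1) * (\<Sum>i<n. cexp n (\<lambda>e. \<rho> e (cflip i e) powr p)) \<le> E powr p"
proof -
  have "(\<Sum>i<n. cexp n (\<lambda>e. \<rho> e (cflip i e) powr p)) \<le> (\<Sum>i<n. (E / n) powr p)"
    using assms by (intro sum_mono cexp_le powr_mono2) auto
  then have "real n powr (p - 1) * (\<Sum>i<n. cexp n (\<lambda>e. \<rho> e (cflip i e) powr p))
      \<le> real n powr (p - 1) * (\<Sum>i<n. (E / n) powr p)"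
    by (intro mult_left_mono) auto
  also have "\<dots> = E powr p" using assms by (simp add: powr_divide powr_diff)
  finally show ?thesis .
qed

lemma ham_nonneg: "0 \<le> ham n e d"
  by (simp add: ham_def)

lemma ham_cflip: "i < n \<Longrightarrow> ham n e (cflip i e) = 1 / n"
proof -
  assume "i < n"
  then have "{j. j < n \<and> e j \<noteq> cflip i e j} = {i}" by (auto simp: cflip_def)
  then show ?thesis by (simp add: ham_def)
qed

lemma ham_cneg: "0 < n \<Longrightarrow> ham n e (cneg n e) = 1"
proof -
  assume "0 < n"
  moreover have "{j. j < n \<and> e j \<noteq> cneg n e j} = {..<n}" by (auto simp: cneg_def)
  ultimately show ?thesis by (simp add: ham_def)
qed

lemma cube_pmetric_of_map:
  assumes "Metric_space X dX" "f \<in> cube n \<rightarrow> X"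
  shows "cube_pmetric n (\<lambda>e d. dX (f e) (f d))"
proof -
  interpret Metric_space X dX by fact
  show ?thesis
    using assms(2) by unfold_locales (auto simp: commute zero Pi_iff intro!: triangle)
qed

lemma cubeLip_upper:
  assumes "Metric_space X dX" "f \<in> cube n \<rightarrow> X" "e \<in> cube n" "d \<in> cube n"
  shows "dX (f e) (f d) \<le> cubeLip n dX f * ham n e d"
proof -
  interpret Metric_space X dX by fact
  show ?thesis
  proof (cases "ham n e d = 0")
    case True
    \<comment> \<open>For \<open>n = 0\<close> the value 0 comes from division by zero, but that
      cube has a single vertex.\<close>
    have "card {i. e i \<noteq> d i} = 0 \<or> n = 0" using True ham_eq[OF assms(3,4)] by simp
    then have "{i. e i \<noteq> d i} = {}"
      using differ_subset[OF assms(3,4)] by (auto dest: finite_subset simp: card_eq_0_iff)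
    then have "e = d" by auto
    moreover have "f e \<in> X" using assms by auto
    ultimately show ?thesis using True zero[of "f e" "f e"] by auto
  next
    case False
    then have pos: "0 < ham n e d" using ham_nonneg[of n e d] by simp
    have "dX (f e) (f d) / ham n e d
        \<in> (\<lambda>(e, d). dX (f e) (f d) / ham n e d) ` (cube n \<times> cube n)"
      using assms(3,4) by (intro image_eqI[of _ _ "(e, d)"]) auto
    then have "dX (f e) (f d) / ham n e d \<le> cubeLip n dX f"
      unfolding cubeLip_def
      by (intro cSup_upper bdd_above_finite finite_imageI finite_cartesian_product finite_cube)
    then show ?thesis using pos by (simp add: field_simps)
  qed
qed

text \<open>The supremum also runs over pairs with \<open>ham\<close> equal to 0, whose quotient is
  0 by the convention on division; \<open>0 \<le> B\<close> covers these.\<close>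

lemma cubeLip_least:
  assumes "0 \<le> B" "\<And>e d. \<lbrakk>e \<in> cube n; d \<in> cube n\<rbrakk> \<Longrightarrow> dX (f e) (f d) \<le> B * ham n e d"
  shows "cubeLip n dX f \<le> B"
  unfolding cubeLip_def
proof (rule cSup_least)
  show "(\<lambda>(e, d). dX (f e) (f d) / ham n e d) ` (cube n \<times> cube n) \<noteq> {}" using zero_in_cube by auto
  fix x assume "x \<in> (\<lambda>(e, d). dX (f e) (f d) / ham n e d) ` (cube n \<times> cube n)"
  then obtain e d where ed: "e \<in> cube n" "d \<in> cube n" "x = dX (f e) (f d) / ham n e d" by auto
  show "x \<le> B"
  proof (cases "ham n e d = 0")
    case False
    then have "0 < ham n e d" using ham_nonneg[of n e d] by simp
    with ed assms(2)[of e d] show ?thesis by (simp add: divide_le_eq)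
  qed (use ed assms in simp)
qed

section \<open>Positive upper limits and the factoring condition\<close>

lemma limsup_pos_imp_frequently:
  assumes "0 < limsup (\<lambda>n. ereal (g n))"
  obtains \<beta> where "0 < \<beta>" "\<And>N. \<exists>n\<ge>N. \<beta> < g n"
proof -
  obtain \<beta> where \<beta>: "0 < ereal \<beta>" "ereal \<beta> < limsup (\<lambda>n. ereal (g n))"
    using ereal_dense2[OF assms] by blast
  have "\<exists>n\<ge>N. \<beta> < g n" for N
  proof (rule ccontr)
    assume "\<not> ?thesis"
    then have "eventually (\<lambda>n. ereal (g n) \<le> ereal \<beta>) sequentially"
      by (auto simp: eventually_sequentially not_less)
    then have "limsup (\<lambda>n. ereal (g n)) \<le> ereal \<beta>" by (rule Limsup_bounded)
    with \<beta> show False by simp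
  qed
  with \<beta> that show ?thesis by simp
qed

text \<open>Index 0 is left out because on the one-point cube antipodes coincide, so no positive
  lower bound can be expected there.\<close>

lemma limsup_pos_of_eventually_ge:
  assumes "0 < \<beta>" "\<And>n. 0 < n \<Longrightarrow> \<beta> \<le> g n"
  shows "0 < limsup (\<lambda>n. ereal (g n))"
proof -
  have "ereal \<beta> \<le> liminf (\<lambda>n. ereal (g n))"
    using assms by (intro Liminf_bounded eventually_sequentiallyI[of 1]) auto
  also have "\<dots> \<le> limsup (\<lambda>n. ereal (g n))" by (rule Liminf_le_Limsup) simp
  finally show ?thesis using assms(1) by (meson ereal_less(2) less_le_trans)
qed

lemma factor_condI:
  assumes "(X, dX, Y, dY, F) \<in> FF" "f \<in> cube n \<rightarrow> X" "0 < a" "0 < b" "a * c \<le> b"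
    and "\<And>e d. \<lbrakk>e \<in> cube n; d \<in> cube n\<rbrakk> \<Longrightarrow>
      a / D * ham n e d \<le> dX (f e) (f d) \<and> dX (f e) (f d) \<le> a * D * ham n e d \<and>
      b / D * ham n e d \<le> dY (F (f e)) (F (f d)) \<and> dY (F (f e)) (F (f d)) \<le> b * D * ham n e d"
  shows "factor_cond FF c D n"
  unfolding factor_cond_def
  by (rule bexI[OF _ assms(1)], unfold case_prod_conv, rule exI[of _ f], rule conjI[OF assms(2)],
      rule exI[of _ a], rule conjI[OF assms(3)], rule exI[of _ b], rule conjI[OF assms(4)])
    (use assms(5,6) in blast)

lemma factor_condE:
  assumes "factor_cond FF c D n"
  obtains X dX Y dY F f a b where "(X, dX, Y, dY, F) \<in> FF" "f \<in> cube n \<rightarrow> X"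
    "0 < a" "0 < b" "a * c \<le> b"
    "\<And>e d. \<lbrakk>e \<in> cube n; d \<in> cube n\<rbrakk> \<Longrightarrow>
      a / D * ham n e d \<le> dX (f e) (f d) \<and> dX (f e) (f d) \<le> a * D * ham n e d \<and>
      b / D * ham n e d \<le> dY (F (f e)) (F (f d)) \<and> dY (F (f e)) (F (f d)) \<le> b * D * ham n e d"
  using assms unfolding factor_cond_def by fast

text \<open>The one vertex of \<open>cube 0\<close> is also a vertex of \<open>cube 1\<close>, and
  all distances involved are 0. The extraction of cubes needs positive dimension, so dimension 0 is
  settled here.\<close>

lemma factor_cond_0_of_1:
  assumes "factor_cond FF c D 1"
  shows "factor_cond FF c D 0"
proof -
  from assms(1) obtain X dX Y dY F f a b where m: "(X, dX, Y, dY, F) \<in> FF" and f: "f \<in> cube 1 \<rightarrow> X"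
    and ab: "0 < a" "0 < b" "a * c \<le> b"
    and est: "\<And>e d. \<lbrakk>e \<in> cube 1; d \<in> cube 1\<rbrakk> \<Longrightarrow> a / D * ham 1 e d \<le> dX (f e) (f d) \<and>
      dX (f e) (f d) \<le> a * D * ham 1 e d \<and> b / D * ham 1 e d \<le> dY (F (f e)) (F (f d)) \<and>
      dY (F (f e)) (F (f d)) \<le> b * D * ham 1 e d"
    by (rule factor_condE) blast
  have "cube 0 = {\<lambda>_. False}" by (auto simp: cube_def)
  then have "f \<in> cube 0 \<rightarrow> X" "\<forall>e\<in>cube 0. \<forall>d\<in>cube 0. a / D * ham 0 e d \<le> dX (f e) (f d) \<and>
      dX (f e) (f d) \<le> a * D * ham 0 e d \<and> b / D * ham 0 e d \<le> dY (F (f e)) (F (f d)) \<and>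
      dY (F (f e)) (F (f d)) \<le> b * D * ham 0 e d"
    using f est[OF zero_in_cube zero_in_cube] zero_in_cube[of 1] by (auto simp: ham_def)
  with m ab show ?thesis by (intro factor_condI) auto
qed

section \<open>The constants compared with factoring of cubes\<close>

context
  fixes lam :: real and FF :: "('a, 'b) metric_map set"
  assumes lam: "0 < lam" and lip_FF: "\<forall>m\<in>FF. lip_map lam m"
begin

lemma lip_map_pmetrics:
  assumes "(X, dX, Y, dY, F) \<in> FF" "f \<in> cube n \<rightarrow> X"
  shows "Metric_space X dX" "cube_pmetric n (\<lambda>e d. dX (f e) (f d))"
    "cube_pmetric n (\<lambda>e d. dY (F (f e)) (F (f d)))"
    "\<And>e d. \<lbrakk>e \<in> cube n; d \<in> cube n\<rbrakk> \<Longrightarrow> dY (F (f e)) (F (f d)) \<le> lam * dX (f e) (f d)"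
proof -
  have *: "Metric_space X dX" "Metric_space Y dY" "F \<in> X \<rightarrow> Y"
    "\<forall>x\<in>X. \<forall>y\<in>X. dY (F x) (F y) \<le> lam * dX x y"
    using lip_FF assms(1) by (auto simp: lip_map_def)
  show "Metric_space X dX" by fact
  show "cube_pmetric n (\<lambda>e d. dX (f e) (f d))" using *(1) assms(2) by (rule cube_pmetric_of_map)
  show "cube_pmetric n (\<lambda>e d. dY (F (f e)) (F (f d)))"
    using *(2) by (rule cube_pmetric_of_map) (use *(3) assms(2) in auto)
  show "dY (F (f e)) (F (f d)) \<le> lam * dX (f e) (f d)" if "e \<in> cube n" "d \<in> cube n" for e d
    using *(4) assms(2) that by auto
qed

text \<open>A violation is a large ratio between the rates at scales n and 1. For given
  \<open>m\<close> and \<open>D\<close>, some violation has n beyond the threshold of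
  \<open>large_rate_ratio_gives_cube\<close>, and the embedded \<open>m\<close>-cube followed by
  \<open>f\<close> is the required map.\<close>

lemma factors_cubes_of_frequent_violations:
  assumes p: "1 < p" and \<beta>: "0 < \<beta>"
    and large: "\<And>N. \<exists>n\<ge>N. \<exists>X dX Y dY F f. (X, dX, Y, dY, F) \<in> FF \<and> f \<in> cube n \<rightarrow> X \<and>
      \<not> cexp n (\<lambda>e. dY (F (f e)) (F (f (cneg n e))) powr p)
          \<le> \<beta> powr p * real n powr (p - 1) * (\<Sum>i<n. cexp n (\<lambda>e. dX (f e) (f (cflip i e)) powr p))"
  shows "factors_cubes FF"
proof -
  define c where "c = (\<beta> powr p / 4) powr (1 / p)"
  have main: "factor_cond FF c D m" if D: "1 < D" and m: "0 < m" for D m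
  proof -
    obtain N where N: "\<And>n \<rho>X \<rho>Y. \<lbrakk>N \<le> n; cube_pmetric n \<rho>X; cube_pmetric n \<rho>Y;
      \<And>e d. \<lbrakk>e \<in> cube n; d \<in> cube n\<rbrakk> \<Longrightarrow> \<rho>Y e d \<le> lam * \<rho>X e d;
      \<beta> powr p * rate n \<rho>X p 1 < rate n \<rho>Y p n\<rbrakk> \<Longrightarrow>
    \<exists>\<phi> a b. \<phi> \<in> cube m \<rightarrow> cube n \<and> 0 < a \<and> 0 < b \<and> a * (\<beta> powr p / 4) powr (1 / p) \<le> b \<and>
      (\<forall>x\<in>cube m. \<forall>y\<in>cube m.
        a / D * ham m x y \<le> \<rho>X (\<phi> x) (\<phi> y) \<and> \<rho>X (\<phi> x) (\<phi> y) \<le> a * D * ham m x y \<and>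
        b / D * ham m x y \<le> \<rho>Y (\<phi> x) (\<phi> y) \<and> \<rho>Y (\<phi> x) (\<phi> y) \<le> b * D * ham m x y)"
      by (rule large_rate_ratio_gives_cube[OF p lam \<beta> m D]) blast
    obtain n X dX Y dY F f where n: "max 1 N \<le> n" and mem: "(X, dX, Y, dY, F) \<in> FF" and f: "f \<in> cube n \<rightarrow> X"
      and viol: "\<not> cexp n (\<lambda>e. dY (F (f e)) (F (f (cneg n e))) powr p)
          \<le> \<beta> powr p * real n powr (p - 1) * (\<Sum>i<n. cexp n (\<lambda>e. dX (f e) (f (cflip i e)) powr p))"
      using large by blast
    have "\<not> rate n (\<lambda>e d. dY (F (f e)) (F (f d))) p n \<le> \<beta> powr p * rate n (\<lambda>e d. dX (f e) (f d)) p 1"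
      using viol n by (subst cexp_le_iff_rate_le[symmetric]) auto
    then have rate: "\<beta> powr p * rate n (\<lambda>e d. dX (f e) (f d)) p 1 < rate n (\<lambda>e d. dY (F (f e)) (F (f d))) p n"
      by simp
    obtain \<phi> a b where \<phi>: "\<phi> \<in> cube m \<rightarrow> cube n" and ab: "0 < a" "0 < b" "a * c \<le> b"
      and est: "\<forall>x\<in>cube m. \<forall>y\<in>cube m.
        a / D * ham m x y \<le> dX (f (\<phi> x)) (f (\<phi> y)) \<and> dX (f (\<phi> x)) (f (\<phi> y)) \<le> a * D * ham m x y \<and>
        b / D * ham m x y \<le> dY (F (f (\<phi> x))) (F (f (\<phi> y))) \<and>
        dY (F (f (\<phi> x))) (F (f (\<phi> y))) \<le> b * D * ham m x y"
      using N[OF _ lip_map_pmetrics(2,3)[OF mem f] lip_map_pmetrics(4)[OF mem f] rate] n unfolding c_def by auto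
    have "f \<circ> \<phi> \<in> cube m \<rightarrow> X" using f \<phi> by auto
    then show ?thesis
      using mem ab est by (intro factor_condI[of X dX Y dY F _ "f \<circ> \<phi>"]) auto
  qed
  have "factor_cond FF c D m" if "1 < D" for D m
    using main[OF that, of m] main[OF that, of 1] factor_cond_0_of_1 by (cases "m = 0") auto
  moreover have "0 < c" using \<beta> by (simp add: c_def)
  ultimately show ?thesis unfolding factors_cubes_def by blast
qed

text \<open>A positive number strictly below the infimum is not admissible, so each large constant
  supplies a violating map.\<close>

lemma factors_cubes_of_b_const:
  assumes "1 < p" "0 < limsup (\<lambda>n. ereal (b_const FF p n))"
  shows "factors_cubes FF"
proof -
  obtain \<beta> where \<beta>: "0 < \<beta>" and freq: "\<And>N. \<exists>n\<ge>N. \<beta> < b_const FF p n"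
    by (rule limsup_pos_imp_frequently[OF assms(2)]) blast
  show ?thesis
  proof (rule factors_cubes_of_frequent_violations[OF assms(1) \<beta>])
    fix N
    obtain n where n: "N \<le> n" "\<beta> < b_const FF p n" using freq by blast
    let ?B = "{b. b > 0 \<and> (\<forall>(X, dX, Y, dY, F)\<in>FF. \<forall>f. f \<in> cube n \<rightarrow> X \<longrightarrow>
        cexp n (\<lambda>e. dY (F (f e)) (F (f (cneg n e))) powr p)
          \<le> b powr p * real n powr (p - 1) *
            (\<Sum>i<n. cexp n (\<lambda>e. dX (f e) (f (cflip i e)) powr p)))}"
    have "bdd_below ?B" by (rule bdd_belowI[of _ 0]) auto
    then have "\<beta> \<notin> ?B" using n(2) cInf_lower[of \<beta> ?B] unfolding b_const_def by linarith
    with \<beta> n(1) show "\<exists>n\<ge>N. \<exists>X dX Y dY F f. (X, dX, Y, dY, F) \<in> FF \<and> f \<in> cube n \<rightarrow> X \<and>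
      \<not> cexp n (\<lambda>e. dY (F (f e)) (F (f (cneg n e))) powr p)
          \<le> \<beta> powr p * real n powr (p - 1) * (\<Sum>i<n. cexp n (\<lambda>e. dX (f e) (f (cflip i e)) powr p))"
      by (intro exI[of _ n]) fast
  qed
qed

text \<open>A map violating the inequality for a_n violates the one with exponent 2 for the same
  constant: edges are at most Lip(f) / n, which bounds the edge energy by Lip(f)^2, while Jensen
  bounds the antipodal second moment from below. Any other exponent above 1 would do as
  well.\<close>

lemma factors_cubes_of_a_const:
  assumes "0 < limsup (\<lambda>n. ereal (a_const FF n))"
  shows "factors_cubes FF"
proof -
  obtain \<alpha> where \<alpha>: "0 < \<alpha>" and freq: "\<And>N. \<exists>n\<ge>N. \<alpha> < a_const FF n"
    by (rule limsup_pos_imp_frequently[OF assms]) blast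
  show ?thesis
  proof (rule factors_cubes_of_frequent_violations[of 2, OF _ \<alpha>])
    fix N
    obtain n where n: "max 1 N \<le> n" "\<alpha> < a_const FF n" using freq by blast
    let ?A = "{a. a > 0 \<and> (\<forall>(X, dX, Y, dY, F)\<in>FF. \<forall>f. f \<in> cube n \<rightarrow> X \<longrightarrow>
        cexp n (\<lambda>e. dY (F (f e)) (F (f (cneg n e)))) \<le> a * cubeLip n dX f)}"
    have "bdd_below ?A" by (rule bdd_belowI[of _ 0]) auto
    then have "\<alpha> \<notin> ?A" using n(2) cInf_lower[of \<alpha> ?A] unfolding a_const_def by linarith
    with \<alpha> obtain X dX Y dY F f where mem: "(X, dX, Y, dY, F) \<in> FF" and f: "f \<in> cube n \<rightarrow> X"
      and viol: "\<not> cexp n (\<lambda>e. dY (F (f e)) (F (f (cneg n e)))) \<le> \<alpha> * cubeLip n dX f"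
      by fast
    interpret X: cube_pmetric n "\<lambda>e d. dX (f e) (f d)" by (rule lip_map_pmetrics(2)[OF mem f])
    interpret Y: cube_pmetric n "\<lambda>e d. dY (F (f e)) (F (f d))" by (rule lip_map_pmetrics(3)[OF mem f])
    let ?l = "cubeLip n dX f"
    have Lip: "dX (f e) (f d) \<le> ?l * ham n e d" if "e \<in> cube n" "d \<in> cube n" for e d
      using cubeLip_upper[OF lip_map_pmetrics(1)[OF mem f] f that] .
    have l0: "0 \<le> ?l"
      using Lip[of "\<lambda>_. False" "cneg n (\<lambda>_. False)"] X.nonneg[of "\<lambda>_. False" "cneg n (\<lambda>_. False)"]
        zero_in_cube cneg_in_cube n by (simp add: ham_cneg)
    have "real n powr (2 - 1) * (\<Sum>i<n. cexp n (\<lambda>e. dX (f e) (f (cflip i e)) powr 2)) \<le> ?l powr 2"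
    proof (rule edge_energy_le[where \<rho> = "\<lambda>e d. dX (f e) (f d)"])
      fix e i assume "e \<in> cube n" "i < n"
      then show "0 \<le> dX (f e) (f (cflip i e)) \<and> dX (f e) (f (cflip i e)) \<le> ?l / n"
        using Lip[of e "cflip i e"] X.nonneg[of e "cflip i e"] by (simp add: cflip_in_cube ham_cflip)
    qed (use n l0 in auto)
    then have "\<alpha> powr 2 * (real n powr (2 - 1) * (\<Sum>i<n. cexp n (\<lambda>e. dX (f e) (f (cflip i e)) powr 2)))
        \<le> \<alpha> powr 2 * ?l powr 2"
      by (intro mult_left_mono) auto
    also have "\<dots> = (\<alpha> * ?l) powr 2" using \<alpha> l0 by (simp add: powr_mult)
    also have "\<dots> < cexp n (\<lambda>e. dY (F (f e)) (F (f (cneg n e)))) powr 2"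
      using viol \<alpha> l0 by (intro powr_less_mono2) auto
    also have "\<dots> \<le> cexp n (\<lambda>e. dY (F (f e)) (F (f (cneg n e))) powr 2)"
      by (intro cexp_powr_le Y.nonneg cneg_in_cube) auto
    finally have "\<not> cexp n (\<lambda>e. dY (F (f e)) (F (f (cneg n e))) powr 2)
        \<le> \<alpha> powr 2 * real n powr (2 - 1) * (\<Sum>i<n. cexp n (\<lambda>e. dX (f e) (f (cflip i e)) powr 2))"
      by (simp only: mult.assoc not_le)
    moreover have "N \<le> n" using n(1) by simp
    ultimately show "\<exists>n\<ge>N. \<exists>X dX Y dY F f. (X, dX, Y, dY, F) \<in> FF \<and> f \<in> cube n \<rightarrow> X \<and>
      \<not> cexp n (\<lambda>e. dY (F (f e)) (F (f (cneg n e))) powr 2)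
          \<le> \<alpha> powr 2 * real n powr (2 - 1) * (\<Sum>i<n. cexp n (\<lambda>e. dX (f e) (f (cflip i e)) powr 2))"
      using mem f by blast
  qed simp
qed

text \<open>Antipodes of the embedded cube are at least b / D apart in Y, and Lip(f) is at most a D.
  Every admissible constant is therefore at least b / (a D^2), hence at least c / D^2.\<close>

lemma a_const_ge:
  assumes "factor_cond FF c D n" "0 < n" "0 < c" "0 < D"
  shows "c / D\<^sup>2 \<le> a_const FF n"
  unfolding a_const_def
proof (rule cInf_greatest)
  let ?P = "\<lambda>a. \<forall>(X, dX, Y, dY, F)\<in>FF. \<forall>f. f \<in> cube n \<rightarrow> X \<longrightarrow>
        cexp n (\<lambda>e. dY (F (f e)) (F (f (cneg n e)))) \<le> a * cubeLip n dX f"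
  \<comment> \<open>The infimum is informative only over a nonempty set; the Lipschitz bound makes
    \<open>lam\<close> admissible.\<close>
  have "cexp n (\<lambda>e. dY (F (f e)) (F (f (cneg n e)))) \<le> lam * cubeLip n dX f"
    if m: "(X, dX, Y, dY, F) \<in> FF" and f: "f \<in> cube n \<rightarrow> X" for X dX Y dY F f
  proof (rule cexp_le)
    fix e assume e: "e \<in> cube n"
    have "dY (F (f e)) (F (f (cneg n e))) \<le> lam * dX (f e) (f (cneg n e))"
      using lip_map_pmetrics(4)[OF m f e cneg_in_cube[OF e]] .
    also have "\<dots> \<le> lam * cubeLip n dX f"
      using cubeLip_upper[OF lip_map_pmetrics(1)[OF m f] f e cneg_in_cube[OF e]] lam assms(2)
      by (simp add: ham_cneg)
    finally show "dY (F (f e)) (F (f (cneg n e))) \<le> lam * cubeLip n dX f" .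
  qed
  then have "?P lam" by auto
  with lam show "{a. a > 0 \<and> ?P a} \<noteq> {}" by blast
  fix a' assume "a' \<in> {a. a > 0 \<and> ?P a}"
  then have a': "0 < a'" "?P a'" by auto
  from assms(1) obtain X dX Y dY F f a b where m: "(X, dX, Y, dY, F) \<in> FF" and f: "f \<in> cube n \<rightarrow> X"
    and ab: "0 < a" "0 < b" "a * c \<le> b"
    and est: "\<And>e d. \<lbrakk>e \<in> cube n; d \<in> cube n\<rbrakk> \<Longrightarrow> a / D * ham n e d \<le> dX (f e) (f d) \<and>
      dX (f e) (f d) \<le> a * D * ham n e d \<and> b / D * ham n e d \<le> dY (F (f e)) (F (f d)) \<and>
      dY (F (f e)) (F (f d)) \<le> b * D * ham n e d"
    by (rule factor_condE) blast
  have "a * c / D \<le> b / D" using ab assms by (intro divide_right_mono) auto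
  also have "b / D \<le> cexp n (\<lambda>e. dY (F (f e)) (F (f (cneg n e))))"
    using est[OF _ cneg_in_cube] assms(2) by (intro cexp_ge) (metis ham_cneg mult.right_neutral)
  also have "\<dots> \<le> a' * cubeLip n dX f" using a' m f by fast
  also have "\<dots> \<le> a' * (a * D)"
    using a' ab assms est by (intro mult_left_mono cubeLip_least) auto
  finally show "c / D\<^sup>2 \<le> a'" using ab assms by (simp add: field_simps power2_eq_square)
qed

text \<open>The argument of \<open>a_const_ge\<close> in p-th powers: edges are at most a D / n, so
  the edge energy is at most (a D)^p.\<close>

lemma b_const_ge:
  assumes "factor_cond FF c D n" "0 < n" "0 < c" "0 < D" "1 < p"
  shows "c / D\<^sup>2 \<le> b_const FF p n"
  unfolding b_const_def
proof (rule cInf_greatest)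
  let ?P = "\<lambda>b. \<forall>(X, dX, Y, dY, F)\<in>FF. \<forall>f. f \<in> cube n \<rightarrow> X \<longrightarrow>
        cexp n (\<lambda>e. dY (F (f e)) (F (f (cneg n e))) powr p)
          \<le> b powr p * real n powr (p - 1) *
            (\<Sum>i<n. cexp n (\<lambda>e. dX (f e) (f (cflip i e)) powr p))"
  \<comment> \<open>Admissibility of \<open>lam\<close> now combines the Lipschitz bound at scale n
    with the comparison of the rates at scales n and 1.\<close>
  have "cexp n (\<lambda>e. dY (F (f e)) (F (f (cneg n e))) powr p)
          \<le> lam powr p * real n powr (p - 1) *
            (\<Sum>i<n. cexp n (\<lambda>e. dX (f e) (f (cflip i e)) powr p))"
    if m: "(X, dX, Y, dY, F) \<in> FF" and f: "f \<in> cube n \<rightarrow> X" for X dX Y dY F f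
  proof -
    let ?X = "\<lambda>e d. dX (f e) (f d)" and ?Y = "\<lambda>e d. dY (F (f e)) (F (f d))"
    have "rate n ?Y p n \<le> lam powr p * rate n ?X p n"
      using lip_map_pmetrics[OF m f] lam assms(5) by (intro rate_le_scaled_rate) auto
    also have "\<dots> \<le> lam powr p * rate n ?X p 1"
      using cube_pmetric.rate_le_rate_1[OF lip_map_pmetrics(2)[OF m f] assms(5,2)]
      by (intro mult_left_mono) auto
    finally show ?thesis using cexp_le_iff_rate_le[OF assms(2), of ?Y p "lam powr p" ?X] by simp
  qed
  then have "?P lam" by auto
  with lam show "{b. b > 0 \<and> ?P b} \<noteq> {}" by blast
  fix b' assume "b' \<in> {b. b > 0 \<and> ?P b}"
  then have b': "0 < b'" "?P b'" by auto
  from assms(1) obtain X dX Y dY F f a b where m: "(X, dX, Y, dY, F) \<in> FF" and f: "f \<in> cube n \<rightarrow> X"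
    and ab: "0 < a" "0 < b" "a * c \<le> b"
    and est: "\<And>e d. \<lbrakk>e \<in> cube n; d \<in> cube n\<rbrakk> \<Longrightarrow> a / D * ham n e d \<le> dX (f e) (f d) \<and>
      dX (f e) (f d) \<le> a * D * ham n e d \<and> b / D * ham n e d \<le> dY (F (f e)) (F (f d)) \<and>
      dY (F (f e)) (F (f d)) \<le> b * D * ham n e d"
    by (rule factor_condE) blast
  interpret X: cube_pmetric n "\<lambda>e d. dX (f e) (f d)" by (rule lip_map_pmetrics(2)[OF m f])
  have "(b / D) powr p \<le> cexp n (\<lambda>e. dY (F (f e)) (F (f (cneg n e))) powr p)"
  proof (rule cexp_ge)
    fix e assume e: "e \<in> cube n"
    have "b / D \<le> dY (F (f e)) (F (f (cneg n e)))"
      using est[OF e cneg_in_cube[OF e]] assms(2) by (simp add: ham_cneg)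
    then show "(b / D) powr p \<le> dY (F (f e)) (F (f (cneg n e))) powr p"
      using ab assms by (intro powr_mono2) auto
  qed
  also have "\<dots> \<le> b' powr p * real n powr (p - 1) *
      (\<Sum>i<n. cexp n (\<lambda>e. dX (f e) (f (cflip i e)) powr p))"
    using b' m f by fast
  also have "\<dots> = b' powr p * (real n powr (p - 1) *
      (\<Sum>i<n. cexp n (\<lambda>e. dX (f e) (f (cflip i e)) powr p)))" by (simp add: mult.assoc)
  also have "\<dots> \<le> b' powr p * (a * D) powr p"
  proof (intro mult_left_mono edge_energy_le[where \<rho> = "\<lambda>e d. dX (f e) (f d)"])
    fix e i assume e: "e \<in> cube n" "i < n"
    then show "0 \<le> dX (f e) (f (cflip i e)) \<and> dX (f e) (f (cflip i e)) \<le> a * D / n"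
      using est[of e "cflip i e"] X.nonneg[of e "cflip i e"] by (simp add: cflip_in_cube ham_cflip)
  qed (use assms ab in auto)
  also have "\<dots> = (b' * (a * D)) powr p" using b' ab assms by (simp add: powr_mult)
  finally have "b / D \<le> b' * (a * D)"
    using powr_less_mono2[of p "b' * (a * D)" "b / D"] b' ab assms by force
  moreover have "a * c / D \<le> b / D" using ab assms by (intro divide_right_mono) auto
  ultimately have "a * c / D \<le> b' * (a * D)" by linarith
  then show "c / D\<^sup>2 \<le> b'" using ab assms by (simp add: field_simps power2_eq_square)
qed

end

theorem mainTheorem1:
  fixes lam :: real and FF :: "('a, 'b) metric_map set"
  assumes "lam > 0"
    and "\<forall>m\<in>FF. lip_map lam m"
  shows "(factors_cubes FF \<longleftrightarrow> crudely_factors_cubes FF)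
    \<and> (crudely_factors_cubes FF \<longleftrightarrow> limsup (\<lambda>n. ereal (a_const FF n)) > 0)
    \<and> (limsup (\<lambda>n. ereal (a_const FF n)) > 0 \<longleftrightarrow>
         (\<forall>p::real. 1 < p \<longrightarrow> limsup (\<lambda>n. ereal (b_const FF p n)) > 0))
    \<and> ((\<forall>p::real. 1 < p \<longrightarrow> limsup (\<lambda>n. ereal (b_const FF p n)) > 0) \<longleftrightarrow>
         (\<exists>p::real. 1 < p \<and> limsup (\<lambda>n. ereal (b_const FF p n)) > 0))"
proof -
  \<comment> \<open>Any fixed distortion above 1 serves, for instance 2.\<close>
  have 12: "crudely_factors_cubes FF" if "factors_cubes FF"
    using that unfolding factors_cubes_def crudely_factors_cubes_def
    by (metis one_less_numeral_iff semiring_norm(76) zero_less_numeral)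
  have 23: "0 < limsup (\<lambda>n. ereal (a_const FF n))"
    and 24: "1 < p \<Longrightarrow> 0 < limsup (\<lambda>n. ereal (b_const FF p n))"
    if crude: "crudely_factors_cubes FF" for p
  proof -
    obtain c D where cD: "0 < c" "0 < D" and fc: "\<And>n. factor_cond FF c D n"
      using crude unfolding crudely_factors_cubes_def by blast
    then have pos: "0 < c / D\<^sup>2" by simp
    show "0 < limsup (\<lambda>n. ereal (a_const FF n))"
      using a_const_ge[OF assms fc _ cD] by (rule limsup_pos_of_eventually_ge[OF pos])
    show "0 < limsup (\<lambda>n. ereal (b_const FF p n))" if "1 < p"
      using b_const_ge[OF assms fc _ cD that] by (rule limsup_pos_of_eventually_ge[OF pos])
  qed
  \<comment> \<open>The exponent 2 gives the passage from every exponent to some exponent.\<close>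
  have two: "1 < (2::real)" by simp
  show ?thesis
    using 12 23 24 two factors_cubes_of_a_const[OF assms] factors_cubes_of_b_const[OF assms] by blast
qed

end
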